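(* Let $1\le p\le\infty$, $\beta\in\mathbb{R}$, $r>1$ and $n\in\mathbb{N}$ satisfy $$n+1\le r\le n^2 .$$ Then for $p=1$ $$\mathcal{E}_n(W^r_{\beta,1})_C=n^{-r}\Big(\frac{1}{\pi(1-e^{-r/n})}+O(1)\,r\,n^{-2}e^{-r/n}\Big),$$ and for $1<p\le\infty$ $$\mathcal{E}_n(W^r_{\beta,p})_C=n^{-r}\Big(\frac{\|\cos t\|_{p'}}{\pi}\,F^{\frac1{p'}}\Big(\frac{p'}{2},\frac{p'}{2};1;e^{-2r/n}\Big)+O(1)\,r\,n^{-2}e^{-r/n}\Big),\qquad \frac1p+\frac1{p'}=1,$$ where the quantities $O(1)$ are uniformly bounded with respect to all parameters considered, i.e. bounded in absolute value by an absolute constant independent of $p,\beta,r,n$.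
   Context: $L_p$, $1\le p<\infty$, is the space of $2\pi$-periodic functions $\varphi$ with $\|\varphi\|_p=\big(\int_{-\pi}^{\pi}|\varphi(t)|^p\,dt\big)^{1/p}<\infty$; $L_\infty$ is the space of $2\pi$-periodic measurable essentially bounded functions with $\|\varphi\|_\infty=\operatorname{ess\,sup}_t|\varphi(t)|$; $C$ is the space of $2\pi$-periodic continuous functions with $\|\varphi\|_C=\max_t|\varphi(t)|$. For $1\le p\le\infty$ let $B_p^0=\{\varphi\in L_p:\ \|\varphi\|_p\le 1,\ \int_{-\pi}^{\pi}\varphi(t)\,dt=0\}$. For $r>0$, $\beta\in\mathbb{R}$, the Weyl--Nagy class $W^r_{\beta,p}$ is the set of all $2\pi$-periodic functions $f$ of the form $$f(x)=\frac{a_0}{2}+\frac1\pi\int_{-\pi}^{\pi}\varphi(x-t)B_{r,\beta}(t)\,dt,\quad a_0\in\mathbb{R},\ \varphi\in B_p^0,\qquad B_{r,\beta}(t)=\sum_{k=1}^\infty k^{-r}\cos\Big(kt-\frac{\beta\pi}{2}\Big).$$ For a set $\mathfrak{N}\subset X$, where $X=C$ or $X=L_s$, $1\le s\le\infty$, put $$\mathcal{E}_n(\mathfrak{N})_X=\sup_{f\in\mathfrak{N}}\|f(\cdot)-S_{n-1}(f;\cdot)\|_X,$$ where $S_{n-1}(f;\cdot)$ is the partial Fourier sum of $f$ of order $n-1$ (harmonics $0,1,\dots,n-1$). $F(a,b;c;z)=1+\sum_{k=1}^\infty\frac{(a)_k(b)_k}{(c)_k}\frac{z^k}{k!}$, with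 $(x)_k=x(x+1)\cdots(x+k-1)$, is the Gauss hypergeometric function; $F^{1/s}(\cdot)$ denotes its value raised to the power $1/s$. For $p=\infty$ one has $p'=1$. *)

theory Defs
  imports "HOL-Analysis.Analysis" "HOL-Probability.Essential_Supremum"
begin

text \<open>
  The exponent \<open>p\<close> ranges over the extended reals \<open>1 \<le> p \<le> \<infinity>\<close>. Elements of \<open>L\<^sub>p\<close> are
  functions rather than almost-everywhere classes.
\<close>

definition Lp_space :: "ereal \<Rightarrow> (real \<Rightarrow> real) set" where
  "Lp_space p = {\<phi>. (\<forall>t. \<phi> (t + 2 * pi) = \<phi> t) \<and> \<phi> \<in> borel_measurable lebesgue \<and>
     (if p = \<infinity> then esssup lebesgue (\<lambda>t. ereal \<bar>\<phi> t\<bar>) < \<infinity>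
      else set_integrable lebesgue {-pi..pi} (\<lambda>t. \<bar>\<phi> t\<bar> powr real_of_ereal p))}"

text \<open>Only meaningful on \<open>Lp_space p\<close>; outside it the value is a junk real number.\<close>

definition Lp_norm :: "ereal \<Rightarrow> (real \<Rightarrow> real) \<Rightarrow> real" where
  "Lp_norm p \<phi> =
     (if p = \<infinity> then real_of_ereal (esssup lebesgue (\<lambda>t. ereal \<bar>\<phi> t\<bar>))
      else (LINT t:{-pi..pi}|lebesgue. \<bar>\<phi> t\<bar> powr real_of_ereal p) powr (1 / real_of_ereal p))"

definition Lp_ball0 :: "ereal \<Rightarrow> (real \<Rightarrow> real) set" where
  "Lp_ball0 p = {\<phi> \<in> Lp_space p. Lp_norm p \<phi> \<le> 1 \<and> (LINT t:{-pi..pi}|lebesgue. \<phi> t) = 0}"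

definition weyl_nagy_kernel :: "real \<Rightarrow> real \<Rightarrow> real \<Rightarrow> real" where
  "weyl_nagy_kernel r \<beta> t =
     (\<Sum>k. real (Suc k) powr (- r) * cos (real (Suc k) * t - \<beta> * pi / 2))"

text \<open>
  The representation is required at every point \<open>x\<close>. This is appropriate for \<open>r > 1\<close>, where the
  kernel is continuous and the convolution is defined everywhere; for \<open>0 < r \<le> 1\<close> one would
  only ask for it almost everywhere.
\<close>

definition weyl_nagy_class :: "real \<Rightarrow> real \<Rightarrow> ereal \<Rightarrow> (real \<Rightarrow> real) set" where
  "weyl_nagy_class r \<beta> p = {f. \<exists>a0. \<exists>\<phi>\<in>Lp_ball0 p. \<forall>x.
     f x = a0 / 2 + 1 / pi * (LINT t:{-pi..pi}|lebesgue. \<phi> (x - t) * weyl_nagy_kernel r \<beta> t)}"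

definition fourier_cos_coeff :: "(real \<Rightarrow> real) \<Rightarrow> nat \<Rightarrow> real" where
  "fourier_cos_coeff f k = 1 / pi * (LINT t:{-pi..pi}|lebesgue. f t * cos (real k * t))"

definition fourier_sin_coeff :: "(real \<Rightarrow> real) \<Rightarrow> nat \<Rightarrow> real" where
  "fourier_sin_coeff f k = 1 / pi * (LINT t:{-pi..pi}|lebesgue. f t * sin (real k * t))"

definition fourier_sum :: "nat \<Rightarrow> (real \<Rightarrow> real) \<Rightarrow> real \<Rightarrow> real" where
  "fourier_sum m f x = fourier_cos_coeff f 0 / 2 +
     (\<Sum>k=1..m. fourier_cos_coeff f k * cos (real k * x) + fourier_sin_coeff f k * sin (real k * x))"

text \<open>
  Suprema are taken in the extended reals, so that an equation with a real right-hand side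
  includes the finiteness of the supremum.
\<close>

definition C_norm :: "(real \<Rightarrow> real) \<Rightarrow> ereal" where
  "C_norm \<phi> = (SUP t. ereal \<bar>\<phi> t\<bar>)"

definition fourier_error_C :: "nat \<Rightarrow> (real \<Rightarrow> real) set \<Rightarrow> ereal" where
  "fourier_error_C n N = (SUP f\<in>N. C_norm (\<lambda>x. f x - fourier_sum (n - 1) f x))"

definition hypergeom :: "real \<Rightarrow> real \<Rightarrow> real \<Rightarrow> real \<Rightarrow> real" where
  "hypergeom a b c z = 1 + (\<Sum>k. pochhammer a (Suc k) * pochhammer b (Suc k) / pochhammer c (Suc k) *
     (z ^ Suc k / fact (Suc k)))"

end

theory Submission
  imports Defs
begin

text \<open>
  The remainder \<open>f - S\<^bsub>n-1\<^esub> f\<close> is the convolution of \<open>\<phi> / \<pi>\<close> with the tail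
  \<open>\<Sum>k\<ge>n. k\<^sup>-\<^sup>r cos (kt - \<beta>\<pi>/2)\<close> of the kernel. Put \<open>q = e\<^bsup>-r/n\<^esup>\<close>. Since
  \<open>0 \<le> (1 + j/n)\<^sup>-\<^sup>r - q\<^sup>j \<le> r (j/n)\<^sup>2 (1 + j/n)\<^bsup>-r-1\<^esup>\<close>, the tail times \<open>n\<^sup>r\<close> differs by
  \<open>O(r n\<^sup>-\<^sup>2 q)\<close> from \<open>Re (e\<^bsup>i(nt - \<beta>\<pi>/2)\<^esup> / (1 - q e\<^bsup>it\<^esup>))\<close>. Freezing the factor
  \<open>1 / (1 - q e\<^bsup>it\<^esup>)\<close> on the cells of length \<open>2\<pi>/n\<close> costs another \<open>O(q/n)\<close>, and the resulting
  kernel \<open>P\<close> is on each cell a full period of a cosine. Hence \<open>sgn P |P|\<^bsup>p'-1\<^esup>\<close> has mean zero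
  exactly, so Hoelder's inequality is attained inside the class, and
  \<open>\<parallel>P\<parallel>\<^bsub>p'\<^esub>\<close> factors into \<open>\<parallel>cos\<parallel>\<^bsub>p'\<^esub>\<close> and a Riemann sum for the mean of
  \<open>|1 - q e\<^bsup>it\<^esup>|\<^bsup>-p'\<^esup>\<close>, which is the hypergeometric value by Parseval's identity applied
  to \<open>(1 - q e\<^bsup>it\<^esup>)\<^bsup>-p'/2\<^esup>\<close>.
\<close>

section \<open>Periodic functions and step functions on a grid\<close>

text \<open>The obstacle is the mean-zero condition in \<open>Lp_ball0\<close>: by duality the
  supremum is not the norm of the tail in the dual space but its distance to the constants, which is
  awkward to compute for the exact kernel. The step kernel is shaped so that this distance equals
  its norm. The two bounds on \<open>r\<close> act differently. From \<open>n + 1 \<le> r\<close>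
  one gets q \<le> 1/2, enough decay of the coefficients, and the absorption of errors of order q/n
  into r n^(-2) q. From r \<le> n^2 one gets that (1 + 1/n)^(-r) is at most e q. Uniformity in
  \<open>p\<close> rests on two devices: sup-norm errors of the kernel are paired with
  \<open>\<phi>\<close> through a bound on its L_1 norm valid for every \<open>p\<close>, and the
  Riemann sum is compared with the integral multiplicatively, so that taking the root cancels the
  exponent. For p = 1 the dual norm is a supremum; it is only approached by functions of the ball,
  and the resulting slack is chosen small against the remainder.\<close>

lemma floor_divide_bounds:
  fixes x c :: real
  assumes "c > 0"
  shows "c * of_int \<lfloor>x / c\<rfloor> \<le> x" "x < c * of_int \<lfloor>x / c\<rfloor> + c"
proof -
  have "of_int \<lfloor>x / c\<rfloor> \<le> x / c" by (rule of_int_floor_le)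
  from mult_left_mono[OF this, of c] show "c * of_int \<lfloor>x / c\<rfloor> \<le> x"
    using assms by simp
  have "x / c < of_int \<lfloor>x / c\<rfloor> + 1" by simp
  then show "x < c * of_int \<lfloor>x / c\<rfloor> + c"
    using assms by (simp add: pos_divide_less_eq algebra_simps)
qed

lemma periodic_of_int:
  fixes f :: "real \<Rightarrow> 'a"
  assumes "\<And>t. f (t + 2 * pi) = f t"
  shows "f (t + 2 * pi * of_int m) = f t"
proof -
  have nat: "f (t + 2 * pi * of_nat k) = f t" for t k
  proof (induction k)
    case (Suc k)
    have "f (t + 2 * pi * of_nat (Suc k)) = f ((t + 2 * pi * of_nat k) + 2 * pi)"
      by (simp add: algebra_simps)
    then show ?case using Suc assms by simp
  qed simp
  show ?thesis
  proof (cases "m \<ge> 0")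
    case True
    then show ?thesis using nat[of t "nat m"] by simp
  next
    case False
    then show ?thesis using nat[of "t + 2 * pi * of_int m" "nat (- m)"] by simp
  qed
qed

section \<open>Affine substitutions and integrals over a period\<close>

lemma set_lebesgue_integral_shift:
  fixes f :: "real \<Rightarrow> real"
  shows "(LINT t:{a..b}|lebesgue. f t) = (LINT t:{a - c..b - c}|lebesgue. f (c + t))"
proof -
  have "indicator {a..b} (c + t) = (indicator {a - c..b - c} t :: real)" for t
    by (auto simp: indicator_def)
  then show ?thesis
    unfolding set_lebesgue_integral_def
    using lebesgue_integral_real_affine[of 1 "\<lambda>t. indicator {a..b} t *\<^sub>R f t" c] by simp
qed

lemma set_integrable_lebesgue_shift:
  fixes f :: "real \<Rightarrow> real"
  assumes "set_integrable lebesgue {a..b} f"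
  shows "set_integrable lebesgue {a - c..b - c} (\<lambda>t. f (c + t))"
proof -
  have "indicator {a..b} (c + t) = (indicator {a - c..b - c} t :: real)" for t
    by (auto simp: indicator_def)
  then show ?thesis
    using lebesgue_integrable_real_affine[of "\<lambda>t. indicator {a..b} t *\<^sub>R f t" 1 c] assms
    unfolding set_integrable_def by simp
qed

lemma set_lebesgue_integral_reflect:
  fixes f :: "real \<Rightarrow> real"
  shows "(LINT t:{a..b}|lebesgue. f t) = (LINT t:{c - b..c - a}|lebesgue. f (c - t))"
proof -
  have "indicator {a..b} (c - t) = (indicator {c - b..c - a} t :: real)" for t
    by (auto simp: indicator_def)
  then show ?thesis
    unfolding set_lebesgue_integral_def
    using lebesgue_integral_real_affine[of "-1" "\<lambda>t. indicator {a..b} t *\<^sub>R f t" c] by simp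
qed

lemma set_integrable_lebesgue_reflect:
  fixes f :: "real \<Rightarrow> real"
  assumes "set_integrable lebesgue {a..b} f"
  shows "set_integrable lebesgue {c - b..c - a} (\<lambda>t. f (c - t))"
proof -
  have "indicator {a..b} (c - t) = (indicator {c - b..c - a} t :: real)" for t
    by (auto simp: indicator_def)
  then show ?thesis
    using lebesgue_integrable_real_affine[of "\<lambda>t. indicator {a..b} t *\<^sub>R f t" "-1" c] assms
    unfolding set_integrable_def by simp
qed

text \<open>Finitely many translates of the given period cover \<open>{a..b}\<close>. The base point
  \<open>c\<close> is free because step functions are first integrated over [0, 2 pi].\<close>

lemma periodic_integrable_on_period:
  fixes f :: "real \<Rightarrow> real"
  assumes per: "\<And>t. f (t + 2 * pi) = f t" and int: "set_integrable lebesgue {c..c + 2 * pi} f"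
  shows "set_integrable lebesgue {a..b} f"
proof -
  define cell where "cell m = {c + 2 * pi * of_int m..c + 2 * pi * of_int m + 2 * pi}" for m :: int
  have cell: "set_integrable lebesgue (cell m) f" for m
  proof -
    have "f (2 * pi * of_int (- m) + t) = f t" for t
      using periodic_of_int[of f t "- m"] per by (simp add: add.commute)
    then show ?thesis
      using set_integrable_lebesgue_shift[OF int, of "2 * pi * of_int (- m)"]
      by (simp add: cell_def algebra_simps)
  qed
  define I where "I = {\<lfloor>(a - c) / (2 * pi)\<rfloor>..\<lfloor>(b - c) / (2 * pi)\<rfloor>}"
  have "set_integrable lebesgue (\<Union>m\<in>I. cell m) f"
    by (intro set_integrable_UN cell) (auto simp: I_def cell_def)
  moreover have "{a..b} \<subseteq> (\<Union>m\<in>I. cell m)"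
  proof
    fix t assume t: "t \<in> {a..b}"
    define m where "m = \<lfloor>(t - c) / (2 * pi)\<rfloor>"
    have "m \<in> I"
      using t by (auto simp: I_def m_def intro!: floor_mono divide_right_mono)
    moreover have "t \<in> cell m"
      using floor_divide_bounds[of "2 * pi" "t - c"]
      by (auto simp: cell_def m_def)
    ultimately show "t \<in> (\<Union>m\<in>I. cell m)" by blast
  qed
  ultimately show ?thesis
    by (intro set_integrable_subset[where B = "{a..b}"]) auto
qed

lemma periodic_integrable:
  fixes f :: "real \<Rightarrow> real"
  assumes "\<And>t. f (t + 2 * pi) = f t" and "set_integrable lebesgue {-pi..pi} f"
  shows "set_integrable lebesgue {a..b} f"
  by (rule periodic_integrable_on_period[of f "-pi"]) (use assms in auto)

lemma periodic_integral:
  fixes f :: "real \<Rightarrow> real"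
  assumes per: "\<And>t. f (t + 2 * pi) = f t" and int: "set_integrable lebesgue {-pi..pi} f"
  shows "(LINT t:{a..a + 2 * pi}|lebesgue. f t) = (LINT t:{-pi..pi}|lebesgue. f t)"
proof -
  note I = periodic_integrable[OF per int]
  note eq = set_lebesgue_integral_eq_integral[OF I]
  \<comment> \<open>\<open>c\<close> is the point of -pi + 2 pi Z with \<open>a\<close> in
    \<open>{c..c + 2 * pi}\<close>; the part of \<open>{a..a + 2 * pi}\<close> beyond
    \<open>c + 2 * pi\<close> is moved back by one period onto \<open>{c..a}\<close>.\<close>
  define m where "m = \<lfloor>(a + pi) / (2 * pi)\<rfloor>"
  define c where "c = - pi + 2 * pi * of_int m"
  have c: "c \<le> a" "a \<le> c + 2 * pi"
    using floor_divide_bounds[of "2 * pi" "a + pi"] by (auto simp: c_def m_def)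
  have sh1: "(LINT t:{c..c + 2 * pi}|lebesgue. f t) = (LINT t:{-pi..pi}|lebesgue. f t)"
    using set_lebesgue_integral_shift[of c "c + 2 * pi" f "2 * pi * of_int m"]
      periodic_of_int[of f _ m] per
    by (simp add: c_def add.commute)
  have sh2: "(LINT t:{c + 2 * pi..a + 2 * pi}|lebesgue. f t) = (LINT t:{c..a}|lebesgue. f t)"
    using set_lebesgue_integral_shift[of "c + 2 * pi" "a + 2 * pi" f "2 * pi"] per
    by (simp add: add.commute)
  have "integral {a..c + 2 * pi} f + integral {c + 2 * pi..a + 2 * pi} f = integral {a..a + 2 * pi} f"
    by (rule Henstock_Kurzweil_Integration.integral_combine) (use c eq in auto)
  moreover have "integral {c..a} f + integral {a..c + 2 * pi} f = integral {c..c + 2 * pi} f"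
    by (rule Henstock_Kurzweil_Integration.integral_combine) (use c eq in auto)
  ultimately show ?thesis
    using sh1 sh2 unfolding eq(2) by simp
qed

lemma periodic_reflect:
  fixes f :: "real \<Rightarrow> real"
  assumes per: "\<And>t. f (t + 2 * pi) = f t" and int: "set_integrable lebesgue {-pi..pi} f"
  shows "set_integrable lebesgue {-pi..pi} (\<lambda>t. f (x - t))"
    and "(LINT t:{-pi..pi}|lebesgue. f (x - t)) = (LINT t:{-pi..pi}|lebesgue. f t)"
proof -
  show "set_integrable lebesgue {-pi..pi} (\<lambda>t. f (x - t))"
    using set_integrable_lebesgue_reflect[OF periodic_integrable[OF assms, of "x - pi" "x + pi"], of x]
    by simp
  show "(LINT t:{-pi..pi}|lebesgue. f (x - t)) = (LINT t:{-pi..pi}|lebesgue. f t)"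
    using set_lebesgue_integral_reflect[of "-pi" pi "\<lambda>t. f (x - t)" x] periodic_integral[OF assms, of "x - pi"]
    by (simp add: algebra_simps)
qed

lemma set_integrable_bounded_interval:
  fixes f :: "real \<Rightarrow> real"
  assumes "f \<in> borel_measurable lebesgue" and "\<And>t. \<bar>f t\<bar> \<le> M"
  shows "set_integrable lebesgue {a..b} f"
proof (rule set_integrable_bound[where f = "\<lambda>_. M"])
  show "set_integrable lebesgue {a..b} (\<lambda>_. M)"
    by (rule absolutely_integrable_on_const) auto
  show "set_borel_measurable lebesgue {a..b} f"
    using assms(1) unfolding set_borel_measurable_def
    by (intro borel_measurable_scaleR borel_measurable_indicator) auto
  show "AE x in lebesgue. x \<in> {a..b} \<longrightarrow> norm (f x) \<le> norm M"
    using assms(2) by (auto intro!: AE_I2 order_trans[OF assms(2)])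
qed

text \<open>The reflection t -> pi - t turns cos into -cos and preserves integrals over a period, so
  the value equals its own negative. This is the source of mean zero for the extremal functions,
  both for p > 1 and for p = 1.\<close>

lemma cos_odd_integral_zero:
  fixes h :: "real \<Rightarrow> real"
  assumes odd: "\<And>x. h (- x) = - h x"
    and int: "set_integrable lebesgue {-pi..pi} (\<lambda>t. h (cos t))"
  shows "(LINT t:{-pi..pi}|lebesgue. h (cos t)) = 0"
proof -
  have "(LINT t:{-pi..pi}|lebesgue. h (cos (pi - t))) = (LINT t:{-pi..pi}|lebesgue. h (cos t))"
    by (rule periodic_reflect(2)) (use int in auto)
  then show ?thesis by (simp add: odd set_integral_uminus[OF int])
qed

text \<open>The substitution u = n t + g stretches a cell to a full period of the cosine, so both
  the position \<open>a\<close> and the phase \<open>g\<close> disappear from the value.\<close>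

lemma cos_cell_integral:
  fixes h :: "real \<Rightarrow> real" and n :: nat
  assumes n: "n \<ge> 1" and int: "set_integrable lebesgue {-pi..pi} (\<lambda>t. h (cos t))"
  shows "set_integrable lebesgue {a..a + 2 * pi / n} (\<lambda>t. h (cos (real n * t + g)))"
    and "(LINT t:{a..a + 2 * pi / n}|lebesgue. h (cos (real n * t + g)))
      = (LINT t:{-pi..pi}|lebesgue. h (cos t)) / n"
proof -
  let ?F = "\<lambda>t. indicator {n * a + g..n * a + g + 2 * pi} t *\<^sub>R h (cos t)"
  have per: "h (cos (t + 2 * pi)) = h (cos t)" for t by simp
  note I = periodic_integrable[OF per int]
  have ind: "indicator {n * a + g..n * a + g + 2 * pi} (g + n * t)
      = (indicator {a..a + 2 * pi / n} t :: real)" for t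
    using n by (auto simp: indicator_def field_simps)
  have F: "?F (g + real n * t) = indicator {a..a + 2 * pi / n} t *\<^sub>R h (cos (real n * t + g))" for t
    using n by (auto simp: indicator_def field_simps)
  have "integrable lebesgue (\<lambda>t. ?F (g + real n * t))"
    by (rule lebesgue_integrable_real_affine[of ?F])
      (use I[of "n * a + g" "n * a + g + 2 * pi"] n in \<open>auto simp: set_integrable_def\<close>)
  then show "set_integrable lebesgue {a..a + 2 * pi / n} (\<lambda>t. h (cos (real n * t + g)))"
    unfolding set_integrable_def F .
  have "(\<integral>t. ?F t \<partial>lebesgue) = real n * (\<integral>t. ?F (g + real n * t) \<partial>lebesgue)"
    using lebesgue_integral_real_affine[of "real n" ?F g] n by simp
  then show "(LINT t:{a..a + 2 * pi / n}|lebesgue. h (cos (real n * t + g)))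
      = (LINT t:{-pi..pi}|lebesgue. h (cos t)) / n"
    using periodic_integral[OF per int, of "n * a + g"] n
    unfolding F by (simp add: set_lebesgue_integral_def eq_divide_eq mult.commute)
qed

text \<open>The left end of the cell \<open>[2\<pi>k/n, 2\<pi>(k+1)/n)\<close> containing \<open>t\<close>.\<close>

definition grid :: "nat \<Rightarrow> real \<Rightarrow> real" where
  "grid n t = 2 * pi * of_int \<lfloor>real n * t / (2 * pi)\<rfloor> / real n"

lemma grid_periodic: "n \<ge> 1 \<Longrightarrow> grid n (t + 2 * pi) = grid n t + 2 * pi"
proof -
  assume n: "n \<ge> 1"
  have "real n * (t + 2 * pi) / (2 * pi) = real n * t / (2 * pi) + of_int (int n)"
    by (simp add: field_simps)
  then have "\<lfloor>real n * (t + 2 * pi) / (2 * pi)\<rfloor> = \<lfloor>real n * t / (2 * pi)\<rfloor> + int n"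
    by (simp only: floor_add_int)
  then show ?thesis using n by (simp add: grid_def field_simps)
qed

lemma grid_bounds:
  assumes "n \<ge> 1"
  shows "grid n t \<le> t" "t \<le> grid n t + 2 * pi / n"
proof -
  have n: "real n > 0" using assms by simp
  note b = floor_divide_bounds[of "2 * pi" "real n * t", simplified]
  show "grid n t \<le> t"
    using b(1) n by (simp add: grid_def pos_divide_le_eq mult.commute)
  have "real n * t \<le> 2 * pi * of_int \<lfloor>real n * t / (2 * pi)\<rfloor> + 2 * pi"
    using b(2) by simp
  then have "t \<le> (2 * pi * of_int \<lfloor>real n * t / (2 * pi)\<rfloor> + 2 * pi) / n"
    using n by (simp add: pos_le_divide_eq mult.commute)
  then show "t \<le> grid n t + 2 * pi / n"
    by (simp add: grid_def add_divide_distrib)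
qed

lemma grid_cell:
  assumes "n \<ge> 1" "t \<in> {2 * pi * real k / n..<2 * pi * real k / n + 2 * pi / n}"
  shows "grid n t = 2 * pi * real k / n"
proof -
  have "\<lfloor>real n * t / (2 * pi)\<rfloor> = int k"
    using assms by (intro floor_unique) (auto simp: field_simps)
  then show ?thesis by (simp add: grid_def)
qed

lemma borel_measurable_grid [measurable]: "grid n \<in> borel_measurable borel"
  unfolding grid_def[abs_def] by measurable

lemma grid_cells:
  assumes "n \<ge> 1"
  shows "{0..<2 * pi} = (\<Union>k<n. {2 * pi * real k / n..<2 * pi * real k / n + 2 * pi / n})"
proof (intro equalityI subsetI)
  fix t assume t: "t \<in> {0..<2 * pi}"
  define k where "k = nat \<lfloor>real n * t / (2 * pi)\<rfloor>"
  have k0: "\<lfloor>real n * t / (2 * pi)\<rfloor> \<ge> 0" using t by auto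
  have "real n * t / (2 * pi) < real n" using t assms by (auto simp: field_simps)
  then have "k < n" unfolding k_def using k0 by linarith
  moreover have "real k \<le> real n * t / (2 * pi)" "real n * t / (2 * pi) < real k + 1"
    using floor_correct[of "real n * t / (2 * pi)"] k0 unfolding k_def by auto
  then have "t \<in> {2 * pi * real k / n..<2 * pi * real k / n + 2 * pi / n}"
    using assms by (auto simp: field_simps)
  ultimately show "t \<in> (\<Union>k<n. {2 * pi * real k / n..<2 * pi * real k / n + 2 * pi / n})"
    by blast
next
  fix t assume "t \<in> (\<Union>k<n. {2 * pi * real k / n..<2 * pi * real k / n + 2 * pi / n})"
  then obtain k where k: "k < n" "2 * pi * real k / n \<le> t" "t < 2 * pi * real k / n + 2 * pi / n"
    by auto
  have "2 * pi * real k / n + 2 * pi / n = 2 * pi * (real (Suc k) / n)"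
    by (simp add: algebra_simps add_divide_distrib)
  also have "\<dots> \<le> 2 * pi * 1"
    using k(1) by (intro mult_left_mono) auto
  finally have "t < 2 * pi" using k by simp
  moreover have "0 \<le> t" using k(2) by (meson divide_nonneg_nonneg mult_nonneg_nonneg of_nat_0_le_iff order_trans pi_ge_zero zero_le_numeral)
  ultimately show "t \<in> {0..<2 * pi}" by simp
qed

text \<open>Amplitude and phase are constant on each cell, so the phase integrates out and only the
  average amplitude survives. \<open>h\<close> is left general: it will be a power of the modulus,
  the odd function in the equality case of Hoelder, a constant, and the cut-off used for p =
  1.\<close>

lemma step_integral:
  fixes h a g :: "real \<Rightarrow> real" and n :: nat
  assumes n: "n \<ge> 1" and int: "set_integrable lebesgue {-pi..pi} (\<lambda>t. h (cos t))"
    and per: "\<And>x. a (x + 2 * pi) = a x" "\<And>x. g (x + 2 * pi) = g x"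
  defines "G \<equiv> \<lambda>t. a (grid n t) * h (cos (real n * t + g (grid n t)))"
  shows "set_integrable lebesgue {-pi..pi} G"
    and "(LINT t:{-pi..pi}|lebesgue. G t)
      = (\<Sum>k<n. a (2 * pi * real k / n)) / n * (LINT t:{-pi..pi}|lebesgue. h (cos t))"
proof -
  define x where "x k = 2 * pi * real k / n" for k :: nat
  define C where "C k = {x k..<x k + 2 * pi / n}" for k
  have perG: "G (t + 2 * pi) = G t" for t
  proof -
    have "cos (real n * (t + 2 * pi) + c) = cos ((real n * t + c) + 2 * pi * of_int (int n))" for c
      by (simp add: algebra_simps)
    also have "\<dots> c = cos (real n * t + c)" for c
      using periodic_of_int[of cos "real n * t + c" "int n"] by simp
    finally show ?thesis
      unfolding G_def grid_periodic[OF n] per by simp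
  qed
  have cell: "set_integrable lebesgue (C k) G" 
    "(LINT t:C k|lebesgue. G t) = a (x k) * ((LINT t:{-pi..pi}|lebesgue. h (cos t)) / n)" for k
  proof -
    let ?H = "\<lambda>t. a (x k) * h (cos (real n * t + g (x k)))"
    have eq: "G t = ?H t" if "t \<in> C k" for t
      using grid_cell[OF n] that unfolding C_def x_def G_def by simp
    have H: "set_integrable lebesgue {x k..x k + 2 * pi / n} ?H"
      using cos_cell_integral(1)[OF n int] by simp
    then have H': "set_integrable lebesgue (C k) ?H"
      by (rule set_integrable_subset) (auto simp: C_def)
    have "set_integrable lebesgue (C k) G = set_integrable lebesgue (C k) ?H"
      by (rule set_integrable_cong[OF refl refl eq])
    then show "set_integrable lebesgue (C k) G"
      using H' by (rule iffD2)
    have "(LINT t:C k|lebesgue. G t) = (LINT t:C k|lebesgue. ?H t)"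
      by (rule set_lebesgue_integral_cong) (use eq in \<open>auto simp: C_def\<close>)
    \<comment> \<open>Half-open cells partition the period, while the change of variables was
      carried out on closed ones; they differ by one point.\<close>
    also have "\<dots> = (LINT t:{x k..x k + 2 * pi / n}|lebesgue. ?H t)"
    proof (rule set_integral_cong_set)
      show "set_borel_measurable lebesgue {x k..x k + 2 * pi / n} ?H"
        using H unfolding set_integrable_def set_borel_measurable_def by blast
      show "set_borel_measurable lebesgue (C k) ?H"
        using H' unfolding set_integrable_def set_borel_measurable_def by blast
      have "AE t in lebesgue. t \<noteq> x k + 2 * pi / n"
        by (rule AE_I[where N = "{x k + 2 * pi / n}"]) auto
      then show "AE t in lebesgue. (t \<in> {x k..x k + 2 * pi / n}) = (t \<in> C k)"
        by eventually_elim (auto simp: C_def)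
    qed
    also have "\<dots> = a (x k) * ((LINT t:{-pi..pi}|lebesgue. h (cos t)) / n)"
      using cos_cell_integral(2)[OF n int] by simp
    finally show "(LINT t:C k|lebesgue. G t) = a (x k) * ((LINT t:{-pi..pi}|lebesgue. h (cos t)) / n)" .
  qed
  have U: "{0..<2 * pi} = (\<Union>k<n. C k)"
    unfolding C_def x_def by (rule grid_cells[OF n])
  have disj: "disjoint_family_on C {..<n}"
    unfolding disjoint_family_on_def
  proof (intro ballI impI)
    fix i j assume "i \<in> {..<n}" "j \<in> {..<n}" "i \<noteq> j"
    have "t \<notin> C j" if "t \<in> C i" for t
    proof
      assume "t \<in> C j"
      then have "2 * pi * real i / n = 2 * pi * real j / n"
        using grid_cell[OF n, of t i] grid_cell[OF n, of t j] that
        unfolding C_def x_def by metis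
      then show False using \<open>i \<noteq> j\<close> n by auto
    qed
    then show "C i \<inter> C j = {}" by blast
  qed
  have int0: "set_integrable lebesgue {0..<2 * pi} G"
    unfolding U by (intro set_integrable_UN cell) (auto simp: C_def)
  have val0: "(LINT t:{0..<2 * pi}|lebesgue. G t)
      = (\<Sum>k<n. a (x k) * ((LINT t:{-pi..pi}|lebesgue. h (cos t)) / n))"
    unfolding U by (subst set_integral_finite_Union[OF _ disj cell(1)]) (auto simp: cell(2), simp add: C_def)
  have eqset: "AE t in lebesgue. (t \<in> {0..<2 * pi}) = (t \<in> {0..0 + 2 * pi})"
  proof -
    have "AE t in lebesgue. t \<noteq> 2 * pi"
      by (rule AE_I[where N = "{2 * pi}"]) auto
    then show ?thesis by eventually_elim auto
  qed
  have "set_integrable lebesgue {2 * pi} G"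
  proof -
    have "(\<lambda>t. indicator {2 * pi} t *\<^sub>R G t) = (\<lambda>t. indicator {2 * pi} t *\<^sub>R G (2 * pi))"
      by (auto simp: indicator_def)
    then show ?thesis unfolding set_integrable_def by simp
  qed
  with int0 have "set_integrable lebesgue ({0..<2 * pi} \<union> {2 * pi}) G"
    by (rule set_integrable_Un) auto
  moreover have "{0..<2 * pi} \<union> {2 * pi} = {0..0 + 2 * pi}" by auto
  ultimately have int1: "set_integrable lebesgue {0..0 + 2 * pi} G" by simp
  show int2: "set_integrable lebesgue {-pi..pi} G"
    by (rule periodic_integrable_on_period[OF perG int1])
  have "(LINT t:{-pi..pi}|lebesgue. G t) = (LINT t:{0..0 + 2 * pi}|lebesgue. G t)"
    using periodic_integral[OF perG int2, of 0] by simp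
  also have "\<dots> = (LINT t:{0..<2 * pi}|lebesgue. G t)"
    by (rule set_integral_cong_set[OF _ _ eqset])
       (use int0 int1 in \<open>auto simp: set_integrable_def set_borel_measurable_def\<close>)
  finally show "(LINT t:{-pi..pi}|lebesgue. G t)
      = (\<Sum>k<n. a (2 * pi * real k / n)) / n * (LINT t:{-pi..pi}|lebesgue. h (cos t))"
    unfolding val0 x_def by (simp add: sum_distrib_right sum_divide_distrib)
qed

section \<open>The Fourier remainder as a convolution\<close>

text \<open>The L_1 norms of the terms are at most \<open>c k\<close> times a constant, so
  integration commutes with the sum. Since \<open>c\<close> is nonnegative, any signs must be
  carried by \<open>g\<close>. The weight \<open>w\<close> is successively a trigonometric
  polynomial, an element of the ball, and the sum of such a series itself.\<close>

lemma set_integral_weighted_series: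
  fixes w :: "real \<Rightarrow> real" and g :: "nat \<Rightarrow> real \<Rightarrow> real"
  assumes w: "set_integrable lebesgue A w"
    and g: "\<And>k. g k \<in> borel_measurable borel" "\<And>k t. \<bar>g k t\<bar> \<le> U"
    and c: "summable c" "\<And>k. c k \<ge> 0"
  shows "set_integrable lebesgue A (\<lambda>t. w t * (\<Sum>k. c k * g k t))"
    and "(\<lambda>k. c k * (LINT t:A|lebesgue. w t * g k t)) sums
      (LINT t:A|lebesgue. w t * (\<Sum>k. c k * g k t))"
    and "\<And>t. summable (\<lambda>k. c k * g k t)"
    and "\<And>k. set_integrable lebesgue A (\<lambda>t. w t * g k t)"
proof -
  let ?w = "\<lambda>t. indicator A t * w t"
  have intw: "integrable lebesgue ?w"
    using w unfolding set_integrable_def by simp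
  have gm: "g k \<in> borel_measurable lebesgue" for k
    using g(1) by (simp add: measurable_completion)
  have U: "U \<ge> 0" using g(2)[of 0 0] by linarith
  have int0: "integrable lebesgue (\<lambda>t. ?w t * g k t)" for k
  proof (rule Bochner_Integration.integrable_bound[where f = "\<lambda>t. U * ?w t"])
    show "integrable lebesgue (\<lambda>t. U * ?w t)" using intw by simp
    show "(\<lambda>t. ?w t * g k t) \<in> borel_measurable lebesgue"
      by (intro borel_measurable_times borel_measurable_integrable intw gm)
    show "AE t in lebesgue. norm (?w t * g k t) \<le> norm (U * ?w t)"
      using g(2)[of k] U
      by (intro AE_I2) (auto simp: abs_mult mult.commute intro!: mult_right_mono)
  qed
  then show "set_integrable lebesgue A (\<lambda>t. w t * g k t)" for k
    unfolding set_integrable_def by (simp add: mult.assoc)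
  have sm: "summable (\<lambda>k. c k * g k t)" for t
  proof (rule summable_comparison_test)
    show "\<exists>N. \<forall>k\<ge>N. norm (c k * g k t) \<le> c k * U"
      using g(2) c(2) by (auto simp: abs_mult intro!: mult_left_mono)
    show "summable (\<lambda>k. c k * U)" using c by (intro summable_mult2)
  qed
  then show "\<And>t. summable (\<lambda>k. c k * g k t)" .
  have int: "integrable lebesgue (\<lambda>t. c k * (?w t * g k t))" for k
    using int0 by simp
  have smn: "summable (\<lambda>k. norm (c k * (?w t * g k t)))" for t
  proof (rule summable_comparison_test)
    show "\<exists>N. \<forall>k\<ge>N. norm (norm (c k * (?w t * g k t))) \<le> c k * (\<bar>?w t\<bar> * U)"
      using g(2) c(2) by (auto simp: abs_mult intro!: mult_left_mono)
    show "summable (\<lambda>k. c k * (\<bar>?w t\<bar> * U))" using c by (intro summable_mult2)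
  qed
  have smi: "summable (\<lambda>k. \<integral>t. norm (c k * (?w t * g k t)) \<partial>lebesgue)"
  proof (rule summable_comparison_test)
    have "(\<integral>t. norm (c k * (?w t * g k t)) \<partial>lebesgue) \<le> c k * (U * (\<integral>t. \<bar>?w t\<bar> \<partial>lebesgue))" for k
    proof -
      have "(\<integral>t. norm (c k * (?w t * g k t)) \<partial>lebesgue) \<le> (\<integral>t. (c k * U) * \<bar>?w t\<bar> \<partial>lebesgue)"
      proof (rule integral_mono)
        show "integrable lebesgue (\<lambda>t. norm (c k * (?w t * g k t)))"
          by (intro integrable_norm int)
        show "integrable lebesgue (\<lambda>t. (c k * U) * \<bar>?w t\<bar>)"
          using intw by (intro integrable_mult_right integrable_abs)
        show "norm (c k * (?w t * g k t)) \<le> (c k * U) * \<bar>?w t\<bar>" for t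
        proof -
          have "norm (c k * (?w t * g k t)) = c k * \<bar>?w t\<bar> * \<bar>g k t\<bar>"
            using c(2)[of k] by (simp add: abs_mult)
          also have "\<dots> \<le> c k * \<bar>?w t\<bar> * U"
            using g(2)[of k t] c(2)[of k] by (intro mult_left_mono) auto
          finally show ?thesis by (simp add: mult_ac)
        qed
      qed
      then show ?thesis by (simp add: mult.assoc)
    qed
    moreover have "(\<integral>t. norm (c k * (?w t * g k t)) \<partial>lebesgue) \<ge> 0" for k
      by (rule Bochner_Integration.integral_nonneg) simp
    ultimately show "\<exists>N. \<forall>k\<ge>N. norm (\<integral>t. norm (c k * (?w t * g k t)) \<partial>lebesgue)
        \<le> c k * (U * (\<integral>t. \<bar>?w t\<bar> \<partial>lebesgue))"
      by auto
    show "summable (\<lambda>k. c k * (U * (\<integral>t. \<bar>?w t\<bar> \<partial>lebesgue)))" using c by (intro summable_mult2)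
  qed
  have eq: "(\<Sum>k. c k * (?w t * g k t)) = indicator A t *\<^sub>R (w t * (\<Sum>k. c k * g k t))" for t
    using suminf_mult[OF sm[of t], of "?w t"] by (simp add: mult_ac)
  have "integrable lebesgue (\<lambda>t. \<Sum>k. c k * (?w t * g k t))"
    by (rule integrable_suminf[OF int _ smi]) (use smn in auto)
  then show "set_integrable lebesgue A (\<lambda>t. w t * (\<Sum>k. c k * g k t))"
    unfolding eq set_integrable_def .
  have "(\<lambda>k. \<integral>t. c k * (?w t * g k t) \<partial>lebesgue) sums (\<integral>t. (\<Sum>k. c k * (?w t * g k t)) \<partial>lebesgue)"
    by (rule sums_integral[OF int _ smi]) (use smn in auto)
  then show "(\<lambda>k. c k * (LINT t:A|lebesgue. w t * g k t)) sums
      (LINT t:A|lebesgue. w t * (\<Sum>k. c k * g k t))"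
    unfolding eq by (simp add: set_lebesgue_integral_def mult.assoc)
qed

section \<open>Orthogonality and the Fourier coefficients of a convergent series\<close>

lemma trig_integral:
  fixes j :: int
  shows "(LINT t:{-pi..pi}|lebesgue. cos (of_int j * t)) = (if j = 0 then 2 * pi else 0)"
    and "(LINT t:{-pi..pi}|lebesgue. sin (of_int j * t)) = 0"
proof -
  have ci: "set_integrable lebesgue {-pi..pi} (\<lambda>t. cos (of_int j * t))"
    and si: "set_integrable lebesgue {-pi..pi} (\<lambda>t. sin (of_int j * t))"
    by (intro absolutely_integrable_continuous_real continuous_intros)+
  have ic: "(LINT t:{-pi..pi}|lebesgue. cos (of_int j * t)) = integral {-pi..pi} (\<lambda>t. cos (of_int j * t))"
    and is': "(LINT t:{-pi..pi}|lebesgue. sin (of_int j * t)) = integral {-pi..pi} (\<lambda>t. sin (of_int j * t))"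
    using set_lebesgue_integral_eq_integral(2)[OF ci] set_lebesgue_integral_eq_integral(2)[OF si] by auto
  show "(LINT t:{-pi..pi}|lebesgue. sin (of_int j * t)) = 0"
    unfolding is' by (rule integral_unique)
      (use has_integral_sin_nx[of j] in simp)
  show "(LINT t:{-pi..pi}|lebesgue. cos (of_int j * t)) = (if j = 0 then 2 * pi else 0)"
    unfolding ic by (rule integral_unique)
      (use has_integral_cos_nx[of j] in simp)
qed

lemma trig_orthogonality:
  fixes m k :: nat
  shows "(LINT t:{-pi..pi}|lebesgue. cos (m * t) * cos (k * t)) =
      (if m = k then if m = 0 then 2 * pi else pi else 0)"
    and "(LINT t:{-pi..pi}|lebesgue. sin (m * t) * sin (k * t)) =
      (if m = k \<and> m \<noteq> 0 then pi else 0)"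
    and "(LINT t:{-pi..pi}|lebesgue. cos (m * t) * sin (k * t)) = 0"
    and "(LINT t:{-pi..pi}|lebesgue. sin (m * t) * cos (k * t)) = 0"
proof -
  let ?d = "int m - int k" and ?s = "int m + int k"
  have I: "set_integrable lebesgue {-pi..pi} (\<lambda>t. cos (of_int j * t) / 2)"
    "set_integrable lebesgue {-pi..pi} (\<lambda>t. sin (of_int j * t) / 2)" for j
    by (intro absolutely_integrable_continuous_real continuous_intros; simp)+
  have "(LINT t:{-pi..pi}|lebesgue. cos (m * t) * cos (k * t))
      = (LINT t:{-pi..pi}|lebesgue. cos (of_int ?d * t) / 2 + cos (of_int ?s * t) / 2)"
    by (rule set_lebesgue_integral_cong) (auto simp: left_diff_distrib distrib_right cos_diff cos_add sin_diff sin_add field_simps)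
  then show "(LINT t:{-pi..pi}|lebesgue. cos (m * t) * cos (k * t)) =
      (if m = k then if m = 0 then 2 * pi else pi else 0)"
    by (simp only: set_integral_add(2)[OF I(1) I(1)] set_integral_divide_zero trig_integral; simp)
  have "(LINT t:{-pi..pi}|lebesgue. sin (m * t) * sin (k * t))
      = (LINT t:{-pi..pi}|lebesgue. cos (of_int ?d * t) / 2 - cos (of_int ?s * t) / 2)"
    by (rule set_lebesgue_integral_cong) (auto simp: left_diff_distrib distrib_right cos_diff cos_add sin_diff sin_add field_simps)
  then show "(LINT t:{-pi..pi}|lebesgue. sin (m * t) * sin (k * t)) =
      (if m = k \<and> m \<noteq> 0 then pi else 0)"
    by (simp only: set_integral_diff(2)[OF I(1) I(1)] set_integral_divide_zero trig_integral; simp)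
  have "(LINT t:{-pi..pi}|lebesgue. cos (m * t) * sin (k * t))
      = (LINT t:{-pi..pi}|lebesgue. sin (of_int ?s * t) / 2 - sin (of_int ?d * t) / 2)"
    by (rule set_lebesgue_integral_cong) (auto simp: left_diff_distrib distrib_right cos_diff cos_add sin_diff sin_add field_simps)
  then show "(LINT t:{-pi..pi}|lebesgue. cos (m * t) * sin (k * t)) = 0"
    by (simp only: set_integral_diff(2)[OF I(2) I(2)] set_integral_divide_zero trig_integral; simp)
  have "(LINT t:{-pi..pi}|lebesgue. sin (m * t) * cos (k * t))
      = (LINT t:{-pi..pi}|lebesgue. sin (of_int ?s * t) / 2 + sin (of_int ?d * t) / 2)"
    by (rule set_lebesgue_integral_cong) (auto simp: left_diff_distrib distrib_right cos_diff cos_add sin_diff sin_add field_simps)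
  then show "(LINT t:{-pi..pi}|lebesgue. sin (m * t) * cos (k * t)) = 0"
    by (simp only: set_integral_add(2)[OF I(2) I(2)] set_integral_divide_zero trig_integral; simp)
qed

lemma trig_poly_integral:
  fixes m k :: nat
  assumes "k \<ge> 1"
  shows "(LINT t:{-pi..pi}|lebesgue. cos (m * t) * (A * cos (k * t) + B * sin (k * t))) =
      (if m = k then pi * A else 0)"
    and "(LINT t:{-pi..pi}|lebesgue. sin (m * t) * (A * cos (k * t) + B * sin (k * t))) =
      (if m = k then pi * B else 0)"
proof -
  have I: "set_integrable lebesgue {-pi..pi} (\<lambda>t. C * (cos (m * t) * cos (k * t)))"
    "set_integrable lebesgue {-pi..pi} (\<lambda>t. C * (cos (m * t) * sin (k * t)))"
    "set_integrable lebesgue {-pi..pi} (\<lambda>t. C * (sin (m * t) * cos (k * t)))"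
    "set_integrable lebesgue {-pi..pi} (\<lambda>t. C * (sin (m * t) * sin (k * t)))" for C
    by (intro absolutely_integrable_continuous_real continuous_intros)+
  have "(LINT t:{-pi..pi}|lebesgue. cos (m * t) * (A * cos (k * t) + B * sin (k * t)))
      = (LINT t:{-pi..pi}|lebesgue. A * (cos (m * t) * cos (k * t)) + B * (cos (m * t) * sin (k * t)))"
    by (rule set_lebesgue_integral_cong) (auto simp: algebra_simps)
  then show "(LINT t:{-pi..pi}|lebesgue. cos (m * t) * (A * cos (k * t) + B * sin (k * t))) =
      (if m = k then pi * A else 0)"
    using assms by (simp add: set_integral_add(2)[OF I(1) I(2)] trig_orthogonality)
  have "(LINT t:{-pi..pi}|lebesgue. sin (m * t) * (A * cos (k * t) + B * sin (k * t)))
      = (LINT t:{-pi..pi}|lebesgue. A * (sin (m * t) * cos (k * t)) + B * (sin (m * t) * sin (k * t)))"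
    by (rule set_lebesgue_integral_cong) (auto simp: algebra_simps)
  then show "(LINT t:{-pi..pi}|lebesgue. sin (m * t) * (A * cos (k * t) + B * sin (k * t))) =
      (if m = k then pi * B else 0)"
    using assms by (simp add: set_integral_add(2)[OF I(3) I(4)] trig_orthogonality)
qed

text \<open>Absolute convergence allows termwise integration, so by orthogonality the Fourier
  coefficients of \<open>f\<close> are those of its series, and the partial sum is an initial
  segment of it.\<close>

lemma fourier_remainder_series:
  fixes c A B :: "nat \<Rightarrow> real"
  assumes c: "summable c" "\<And>k. c k \<ge> 0"
    and U: "\<And>k. \<bar>A k\<bar> \<le> U" "\<And>k. \<bar>B k\<bar> \<le> U"
    and f: "\<And>x::real. f x = a / 2 + (\<Sum>k. c k * (A k * cos (real (Suc k) * x) + B k * sin (real (Suc k) * x)))"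
    and n: "n \<ge> 1"
  shows "f x - fourier_sum (n - 1) f x =
    (\<Sum>k. c (k + (n - 1)) * (A (k + (n - 1)) * cos (real (n + k) * x) + B (k + (n - 1)) * sin (real (n + k) * x)))"
proof -
  let ?u = "\<lambda>k x. A k * cos (real (Suc k) * x) + B k * sin (real (Suc k) * x)"
  have u_bd: "\<bar>?u k x\<bar> \<le> 2 * U" for k x
  proof -
    have U0: "U \<ge> 0" using U(1)[of 0] by linarith
    have "\<bar>A k\<bar> * \<bar>cos (real (Suc k) * x)\<bar> \<le> U * 1"
      using U U0 by (intro mult_mono) auto
    moreover have "\<bar>B k\<bar> * \<bar>sin (real (Suc k) * x)\<bar> \<le> U * 1"
      using U U0 by (intro mult_mono) auto
    ultimately show ?thesis
      using abs_triangle_ineq[of "A k * cos (real (Suc k) * x)" "B k * sin (real (Suc k) * x)"]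
      by (simp add: abs_mult)
  qed
  have u_meas: "?u k \<in> borel_measurable borel" for k
    by (intro borel_measurable_continuous_onI continuous_intros)
  have coeff: "(LINT t:{-pi..pi}|lebesgue. w t * f t)
      = a / 2 * (LINT t:{-pi..pi}|lebesgue. w t) + (\<Sum>k. c k * (LINT t:{-pi..pi}|lebesgue. w t * ?u k t))"
    if w: "continuous_on {-pi..pi} w" for w
  proof -
    note wi = absolutely_integrable_continuous_real[OF w]
    note ser = set_integral_weighted_series[where g = ?u, OF wi u_meas u_bd c]
    have "w t * f t = w t * (a / 2) + w t * (\<Sum>k. c k * ?u k t)" for t
      unfolding f by (rule distrib_left)
    then have "(LINT t:{-pi..pi}|lebesgue. w t * f t)
        = (LINT t:{-pi..pi}|lebesgue. w t * (a / 2) + w t * (\<Sum>k. c k * ?u k t))"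
      by simp
    also have "\<dots> = (LINT t:{-pi..pi}|lebesgue. w t * (a / 2)) + (LINT t:{-pi..pi}|lebesgue. w t * (\<Sum>k. c k * ?u k t))"
      using wi ser(1) by (intro set_integral_add(2)) auto
    finally show ?thesis
      using sums_unique[OF ser(2)] by simp
  qed
  \<comment> \<open>Index \<open>k\<close> carries the harmonic \<open>Suc k\<close>, so
    orthogonality leaves only \<open>k = m - 1\<close>, and nothing when \<open>m = 0\<close>: the
    constant coefficient comes from \<open>a\<close> alone.\<close>
  have single: "(\<Sum>k. c k * (if m = Suc k then pi * D k else 0)) = (if m = 0 then 0 else c (m - 1) * (pi * D (m - 1)))"
    for m and D :: "nat \<Rightarrow> real"
  proof -
    have "(\<lambda>k. c k * (if m = Suc k then pi * D k else 0))
        = (\<lambda>k. if k = m - 1 then (if m = 0 then 0 else c k * (pi * D k)) else 0)"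
      by auto
    then show ?thesis
      using sums_unique[OF sums_single[of "m - 1" "\<lambda>k. if m = 0 then 0 else c k * (pi * D k)"]] by simp
  qed
  have cc: "fourier_cos_coeff f m = (if m = 0 then a else c (m - 1) * A (m - 1))" for m
  proof -
    have "(LINT t:{-pi..pi}|lebesgue. f t * cos (real m * t))
        = (LINT t:{-pi..pi}|lebesgue. cos (real m * t) * f t)" by (simp add: mult.commute)
    also have "\<dots> = a / 2 * (LINT t:{-pi..pi}|lebesgue. cos (real m * t))
        + (\<Sum>k. c k * (if m = Suc k then pi * A k else 0))"
      by (subst coeff) (intro continuous_intros, simp add: trig_poly_integral del: of_nat_Suc)
    also have "(LINT t:{-pi..pi}|lebesgue. cos (real m * t)) = (if m = 0 then 2 * pi else 0)"
      using trig_integral(1)[of "int m"] by simp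
    finally show ?thesis
      unfolding fourier_cos_coeff_def single by auto
  qed
  have sc: "fourier_sin_coeff f m = (if m = 0 then 0 else c (m - 1) * B (m - 1))" for m
  proof -
    have "(LINT t:{-pi..pi}|lebesgue. f t * sin (real m * t))
        = (LINT t:{-pi..pi}|lebesgue. sin (real m * t) * f t)" by (simp add: mult.commute)
    also have "\<dots> = a / 2 * (LINT t:{-pi..pi}|lebesgue. sin (real m * t))
        + (\<Sum>k. c k * (if m = Suc k then pi * B k else 0))"
      by (subst coeff) (intro continuous_intros, simp add: trig_poly_integral del: of_nat_Suc)
    also have "(LINT t:{-pi..pi}|lebesgue. sin (real m * t)) = 0"
      using trig_integral(2)[of "int m"] by simp
    finally show ?thesis
      unfolding fourier_sin_coeff_def single by auto
  qed
  have sm: "summable (\<lambda>k. c k * ?u k x)"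
  proof (rule summable_comparison_test)
    show "\<exists>N. \<forall>k\<ge>N. norm (c k * ?u k x) \<le> c k * (2 * U)"
      using u_bd c(2) by (auto simp: abs_mult intro!: mult_left_mono)
    show "summable (\<lambda>k. c k * (2 * U))" using c by (intro summable_mult2)
  qed
  have "fourier_sum (n - 1) f x = a / 2 + (\<Sum>k=1..n - 1. c (k - 1) * ?u (k - 1) x)"
    unfolding fourier_sum_def cc sc
    by (auto intro!: sum.cong simp: algebra_simps)
  also have "(\<Sum>k=1..n - 1. c (k - 1) * ?u (k - 1) x) = (\<Sum>k<n - 1. c k * ?u k x)"
    by (rule sum.reindex_bij_witness[of _ Suc "\<lambda>k. k - 1"]) auto
  finally have "f x - fourier_sum (n - 1) f x = (\<Sum>k. c (k + (n - 1)) * ?u (k + (n - 1)) x)"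
    unfolding f suminf_split_initial_segment[OF sm, of "n - 1"] by simp
  moreover have "Suc (k + (n - 1)) = n + k" for k using n by simp
  ultimately show ?thesis by (simp only:)
qed

text \<open>For \<open>n = 1\<close> and \<open>b = \<beta> * pi / 2\<close> this is the Weyl-Nagy
  kernel itself, so one notion serves both the class and the remainder.\<close>

definition kernel_tail :: "nat \<Rightarrow> real \<Rightarrow> real \<Rightarrow> real \<Rightarrow> real" where
  "kernel_tail n r b t = (\<Sum>k. real (n + k) powr (- r) * cos (real (n + k) * t - b))"

lemma summable_powr_shift:
  assumes "r > 1"
  shows "summable (\<lambda>k. real (k + n) powr (- r))"
  using assms summable_real_powr_iff[of "-r"] by (subst summable_iff_shift) simp

text \<open>Termwise integration turns \<open>f\<close> into a trigonometric series whose
  coefficients \<open>A\<close> and \<open>B\<close> are those of \<open>\<phi>\<close> against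
  waves shifted by \<open>b\<close>. Deleting its harmonics below \<open>n\<close> leaves the
  expansion of the convolution with the tail.\<close>

lemma weyl_nagy_remainder:
  fixes \<phi> :: "real \<Rightarrow> real"
  assumes r: "r > 1" and n: "n \<ge> 1"
    and per: "\<And>t. \<phi> (t + 2 * pi) = \<phi> t" and int: "set_integrable lebesgue {-pi..pi} \<phi>"
    and f: "\<And>x. f x = a / 2 + 1 / pi *
      (LINT t:{-pi..pi}|lebesgue. \<phi> (x - t) * weyl_nagy_kernel r \<beta> t)"
  shows "f x - fourier_sum (n - 1) f x =
    1 / pi * (LINT t:{-pi..pi}|lebesgue. \<phi> t * kernel_tail n r (\<beta> * pi / 2) (x - t))"
proof -
  define b where "b = \<beta> * pi / 2"
  define c where "c k = real (Suc k) powr (- r)" for k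
  define A where "A k = 1 / pi * (LINT t:{-pi..pi}|lebesgue. \<phi> t * cos (real (Suc k) * t + b))" for k
  define B where "B k = 1 / pi * (LINT t:{-pi..pi}|lebesgue. \<phi> t * sin (real (Suc k) * t + b))" for k
  define J where "J = (LINT t:{-pi..pi}|lebesgue. \<bar>\<phi> t\<bar>)"
  have c: "summable c" "\<And>k. c k \<ge> 0"
    using summable_powr_shift[OF r, of 1] by (auto simp: c_def[abs_def])
  \<comment> \<open>The L_1 norm of \<open>\<phi>\<close> bounds all its trigonometric coefficients
    at once, which supplies the common bound \<open>U\<close> of
    \<open>fourier_remainder_series\<close>.\<close>
  have bd_int: "set_integrable lebesgue {-pi..pi} (\<lambda>t. \<phi> t * g t) \<and>
      \<bar>LINT t:{-pi..pi}|lebesgue. \<phi> t * g t\<bar> \<le> J"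
    if g: "continuous_on UNIV g" "\<And>t. \<bar>g t\<bar> \<le> 1" for g
  proof -
    have gm: "g \<in> borel_measurable borel" using g(1) by (rule borel_measurable_continuous_onI)
    have I: "set_integrable lebesgue {-pi..pi} (\<lambda>t. \<phi> t * g t)"
      using set_integral_weighted_series(4)[of "{-pi..pi}" \<phi> "\<lambda>_. g" 1 "\<lambda>_. 0"] int gm g(2) by simp
    moreover have "\<bar>LINT t:{-pi..pi}|lebesgue. \<phi> t * g t\<bar> \<le> J"
    proof -
      have "\<bar>LINT t:{-pi..pi}|lebesgue. \<phi> t * g t\<bar> \<le> (LINT t:{-pi..pi}|lebesgue. \<bar>\<phi> t * g t\<bar>)"
        using set_integral_norm_bound[OF I] by simp
      also have "\<dots> \<le> J"
        unfolding J_def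
      proof (rule set_integral_mono)
        show "set_integrable lebesgue {-pi..pi} (\<lambda>t. \<bar>\<phi> t * g t\<bar>)" by (rule set_integrable_abs[OF I])
        show "set_integrable lebesgue {-pi..pi} (\<lambda>t. \<bar>\<phi> t\<bar>)" by (rule set_integrable_abs[OF int])
        show "\<bar>\<phi> t * g t\<bar> \<le> \<bar>\<phi> t\<bar>" for t
          using mult_left_mono[OF g(2)[of t], of "\<bar>\<phi> t\<bar>"] by (simp add: abs_mult)
      qed
      finally show ?thesis .
    qed
    ultimately show ?thesis by blast
  qed
  have cosI: "set_integrable lebesgue {-pi..pi} (\<lambda>t. \<phi> t * cos (real k * t + b))"
    and sinI: "set_integrable lebesgue {-pi..pi} (\<lambda>t. \<phi> t * sin (real k * t + b))" for k
    by (rule bd_int[THEN conjunct1]; intro continuous_intros abs_cos_le_one abs_sin_le_one)+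
  have U: "\<bar>A k\<bar> \<le> J / pi" "\<bar>B k\<bar> \<le> J / pi" for k
  proof -
    have "\<bar>LINT t:{-pi..pi}|lebesgue. \<phi> t * cos (real (Suc k) * t + b)\<bar> \<le> J"
      "\<bar>LINT t:{-pi..pi}|lebesgue. \<phi> t * sin (real (Suc k) * t + b)\<bar> \<le> J"
      by (rule bd_int[THEN conjunct2]; intro continuous_intros abs_cos_le_one abs_sin_le_one)+
    then show "\<bar>A k\<bar> \<le> J / pi" "\<bar>B k\<bar> \<le> J / pi"
      unfolding A_def B_def by (auto intro!: divide_right_mono simp: abs_mult)
  qed
  have term_eq: "(LINT t:{-pi..pi}|lebesgue. \<phi> t * cos (real (Suc k) * (x - t) - b))
      = pi * (A k * cos (real (Suc k) * x) + B k * sin (real (Suc k) * x))" for k x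
  proof -
    have "(LINT t:{-pi..pi}|lebesgue. \<phi> t * cos (real (Suc k) * (x - t) - b))
        = (LINT t:{-pi..pi}|lebesgue. cos (real (Suc k) * x) * (\<phi> t * cos (real (Suc k) * t + b))
            + sin (real (Suc k) * x) * (\<phi> t * sin (real (Suc k) * t + b)))"
    proof (rule set_lebesgue_integral_cong)
      have "cos (real (Suc k) * (x - t) - b) = cos (real (Suc k) * x - (real (Suc k) * t + b))" for t
        by (simp add: algebra_simps)
      then show "\<forall>t. t \<in> {-pi..pi} \<longrightarrow> \<phi> t * cos (real (Suc k) * (x - t) - b)
          = cos (real (Suc k) * x) * (\<phi> t * cos (real (Suc k) * t + b))
            + sin (real (Suc k) * x) * (\<phi> t * sin (real (Suc k) * t + b))"
        by (simp only: cos_diff) (simp add: algebra_simps)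
    qed simp
    also have "\<dots> = cos (real (Suc k) * x) * (LINT t:{-pi..pi}|lebesgue. \<phi> t * cos (real (Suc k) * t + b))
        + sin (real (Suc k) * x) * (LINT t:{-pi..pi}|lebesgue. \<phi> t * sin (real (Suc k) * t + b))"
      by (subst set_integral_add(2)) (simp_all add: cosI sinI del: of_nat_Suc)
    also have "\<dots> = pi * (A k * cos (real (Suc k) * x) + B k * sin (real (Suc k) * x))"
      by (simp add: A_def B_def distrib_left mult_ac del: of_nat_Suc)
    finally show ?thesis .
  qed
  have conv: "(\<lambda>k. real (m + k) powr (- r) * (LINT t:{-pi..pi}|lebesgue. \<phi> t * cos (real (m + k) * (x - t) - b)))
      sums (LINT t:{-pi..pi}|lebesgue. \<phi> t * kernel_tail m r b (x - t))"
    and convI: "set_integrable lebesgue {-pi..pi} (\<lambda>t. \<phi> t * kernel_tail m r b (x - t))" for m x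
  proof -
    have cm: "summable (\<lambda>k. real (m + k) powr (- r))" 
      using summable_powr_shift[OF r, of m] by (simp add: add.commute)
    have gm: "(\<lambda>t. cos (real (m + k) * (x - t) - b)) \<in> borel_measurable borel" for k
      by (intro borel_measurable_continuous_onI continuous_intros)
    note ser = set_integral_weighted_series[where U = 1, OF int gm _ cm]
    show "(\<lambda>k. real (m + k) powr (- r) * (LINT t:{-pi..pi}|lebesgue. \<phi> t * cos (real (m + k) * (x - t) - b)))
      sums (LINT t:{-pi..pi}|lebesgue. \<phi> t * kernel_tail m r b (x - t))"
      unfolding kernel_tail_def by (rule ser(2)) auto
    show "set_integrable lebesgue {-pi..pi} (\<lambda>t. \<phi> t * kernel_tail m r b (x - t))"
      unfolding kernel_tail_def by (rule ser(1)) auto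
  qed
  have ker: "weyl_nagy_kernel r \<beta> = kernel_tail 1 r b"
    by (rule ext) (simp add: weyl_nagy_kernel_def kernel_tail_def b_def)
  have ker_per: "kernel_tail 1 r b (t + 2 * pi) = kernel_tail 1 r b t" for t
  proof -
    have "cos (real (1 + k) * (t + 2 * pi) - b) = cos (real (1 + k) * t - b)" for k
    proof -
      have "cos (real (1 + k) * (t + 2 * pi) - b) = cos ((real (1 + k) * t - b) + 2 * pi * of_int (int (1 + k)))"
        by (simp add: algebra_simps)
      then show ?thesis
        using periodic_of_int[of cos "real (1 + k) * t - b" "int (1 + k)"] by simp
    qed
    then show ?thesis by (simp only: kernel_tail_def)
  qed
  have f': "f x = a / 2 + (\<Sum>k. c k * (A k * cos (real (Suc k) * x) + B k * sin (real (Suc k) * x)))" for x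
  proof -
    \<comment> \<open>Both factors are periodic, so t -> x - t moves the translation from
      \<open>\<phi>\<close> to the kernel without changing the interval.\<close>
    let ?F = "\<lambda>t. \<phi> t * kernel_tail 1 r b (x - t)"
    have perF: "?F (t + 2 * pi) = ?F t" for t
      using ker_per[of "x - t - 2 * pi"] per[of t] by (simp add: algebra_simps)
    have "(LINT t:{-pi..pi}|lebesgue. \<phi> (x - t) * weyl_nagy_kernel r \<beta> t)
        = (LINT t:{-pi..pi}|lebesgue. ?F (x - t))"
      by (simp add: ker)
    also have "\<dots> = (LINT t:{-pi..pi}|lebesgue. ?F t)"
      by (rule periodic_reflect(2)[OF perF convI])
    also have "\<dots> = (\<Sum>k. c k * (pi * (A k * cos (real (Suc k) * x) + B k * sin (real (Suc k) * x))))"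
      using sums_unique[OF conv[of 1 x]] term_eq by (simp add: c_def)
    also have "\<dots> = (\<Sum>k. pi * (c k * (A k * cos (real (Suc k) * x) + B k * sin (real (Suc k) * x))))"
      by (simp add: mult_ac)
    also have "\<dots> = pi * (\<Sum>k. c k * (A k * cos (real (Suc k) * x) + B k * sin (real (Suc k) * x)))"
    proof (rule suminf_mult)
      have "summable (\<lambda>k. 1 / pi * (c k * (pi * (A k * cos (real (Suc k) * x) + B k * sin (real (Suc k) * x)))))"
        using sums_summable[OF conv[of 1 x]] term_eq by (intro summable_mult) (simp add: c_def)
      then show "summable (\<lambda>k. c k * (A k * cos (real (Suc k) * x) + B k * sin (real (Suc k) * x)))"
        by simp
    qed
    finally show ?thesis by (simp add: f)
  qed
  have "f x - fourier_sum (n - 1) f x =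
      (\<Sum>k. c (k + (n - 1)) * (A (k + (n - 1)) * cos (real (n + k) * x) + B (k + (n - 1)) * sin (real (n + k) * x)))"
    by (rule fourier_remainder_series[OF c U f' n])
  also have "\<dots> = (\<Sum>k. 1 / pi * (real (n + k) powr (- r) *
      (LINT t:{-pi..pi}|lebesgue. \<phi> t * cos (real (n + k) * (x - t) - b))))"
  proof (rule suminf_cong)
    fix k
    have s: "Suc (k + (n - 1)) = n + k" using n by simp
    show "c (k + (n - 1)) * (A (k + (n - 1)) * cos (real (n + k) * x) + B (k + (n - 1)) * sin (real (n + k) * x))
      = 1 / pi * (real (n + k) powr (- r) *
      (LINT t:{-pi..pi}|lebesgue. \<phi> t * cos (real (n + k) * (x - t) - b)))"
      using term_eq[of "k + (n - 1)" x] unfolding c_def s by simp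
  qed
  also have "\<dots> = 1 / pi * (LINT t:{-pi..pi}|lebesgue. \<phi> t * kernel_tail n r b (x - t))"
    using sums_unique[OF sums_mult[OF conv[of n x], of "1 / pi"]] by simp
  finally show ?thesis by (simp add: b_def)
qed

section \<open>Approximation of the kernel tail\<close>

text \<open>With u = x - ln (1 + x) the exponential is (1 + x)^(-r) exp (-r u), and 0 \<le> u \<le>
  x^2 / (1 + x), where the upper bound is ln y \<le> y - 1 at y = 1 / (1 + x). The denominator 1 + x
  is what raises the exponent from r to r + 1.\<close>

lemma one_plus_powr_minus_exp:
  fixes x r :: real
  assumes "x \<ge> 0" "r \<ge> 0"
  shows "0 \<le> (1 + x) powr (- r) - exp (- r * x)"
    and "(1 + x) powr (- r) - exp (- r * x) \<le> r * x\<^sup>2 * (1 + x) powr (- (r + 1))"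
proof -
  define A where "A = (1 + x) powr (- r)"
  define u where "u = x - ln (1 + x)"
  have A: "A = exp (- r * ln (1 + x))" using assms by (simp add: A_def powr_def)
  have u0: "u \<ge> 0" using ln_add_one_self_le_self[OF assms(1)] by (simp add: u_def)
  have "ln (1 / (1 + x)) \<le> 1 / (1 + x) - 1"
    using assms by (intro ln_le_minus_one) auto
  moreover have "ln (1 / (1 + x)) = - ln (1 + x)"
    using assms by (simp add: ln_div)
  ultimately have "u \<le> x - 1 + 1 / (1 + x)" by (simp add: u_def)
  also have "\<dots> = x\<^sup>2 / (1 + x)" using assms by (simp add: field_simps power2_eq_square)
  finally have u1: "u \<le> x\<^sup>2 / (1 + x)" .
  have e: "exp (- r * x) = A * exp (- (r * u))"
    unfolding A exp_add[symmetric] u_def by (simp add: algebra_simps)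
  have A0: "A \<ge> 0" by (simp add: A_def)
  show "0 \<le> (1 + x) powr (- r) - exp (- r * x)"
    unfolding A_def[symmetric] e using A0 u0 assms mult_left_mono[of "exp (- (r * u))" 1 A] by auto
  have "1 - exp (- (r * u)) \<le> r * u" using exp_ge_add_one_self[of "- (r * u)"] by linarith
  also have "\<dots> \<le> r * (x\<^sup>2 / (1 + x))" using u1 assms by (intro mult_left_mono) auto
  finally have "A * (1 - exp (- (r * u))) \<le> A * (r * (x\<^sup>2 / (1 + x)))"
    using A0 by (intro mult_left_mono) auto
  also have "\<dots> = r * x\<^sup>2 * (1 + x) powr (- (r + 1))"
    using assms by (simp add: A_def powr_diff)
  finally show "(1 + x) powr (- r) - exp (- r * x) \<le> r * x\<^sup>2 * (1 + x) powr (- (r + 1))"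
    unfolding A_def[symmetric] e by (simp add: algebra_simps)
qed

text \<open>Weighted arithmetic-geometric mean inequality for 1 + a y and 1 with weights 1/a and 1 -
  1/a, raised to the power \<open>a\<close>.\<close>

lemma Bernoulli_inequality_powr:
  fixes a y :: real
  assumes "a \<ge> 1" "y \<ge> 0"
  shows "1 + a * y \<le> (1 + y) powr a"
proof -
  have "(1 + a * y) powr (1 / a) * 1 powr (1 - 1 / a) \<le> 1 / a * (1 + a * y) + (1 - 1 / a) * 1"
    using assms by (intro Youngs_inequality_0) (auto intro: add_pos_nonneg)
  also have "\<dots> = 1 + y" using assms by (simp add: field_simps)
  finally have "(1 + a * y) powr (1 / a) \<le> 1 + y" by simp
  then have "((1 + a * y) powr (1 / a)) powr a \<le> (1 + y) powr a"
    using assms by (intro powr_mono2) auto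
  then show ?thesis using assms by (simp add: powr_powr add_nonneg_nonneg)
qed

text \<open>
  The exponent \<open>r + 1\<close> rather than \<open>r\<close> matters: for \<open>n = 2\<close>, \<open>r = 3\<close> a bound of order
  \<open>j\<^sup>-\<^sup>3\<close> would leave a divergent series after multiplication by \<open>j\<^sup>2\<close>.
\<close>

lemma tail_coefficient_bound:
  fixes n j :: nat and r :: real
  assumes n: "n \<ge> 2" and r: "real n + 1 \<le> r" "r \<le> (real n)\<^sup>2" and j: "j \<ge> 1"
  shows "(1 + j / n) powr (- (r + 1)) \<le> 256 * exp 1 * exp (- r / n) / real j ^ 4"
proof -
  have n0: "real n > 0" using n by simp
  \<comment> \<open>Chosen so that 1 + j/n = (1 + 1/n) (1 + y): the first factor produces q, the
    second the decay in \<open>j\<close>.\<close>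
  define y where "y = (real j - 1) / (real n + 1)"
  have y0: "y \<ge> 0" using j by (simp add: y_def)
  have split: "1 + j / n = (1 + 1 / n) * (1 + y)"
  proof -
    have "1 + y = (real n + real j) / (real n + 1)"
      using n0 by (simp add: y_def field_simps)
    moreover have "1 + 1 / n = (real n + 1) / n" "1 + j / n = (real n + real j) / n"
      using n0 by (simp_all add: field_simps)
    moreover have "real n + 1 \<noteq> 0" using n0 by linarith
    ultimately show ?thesis by simp
  qed
  \<comment> \<open>The product r ln (1 + 1/n) falls short of r/n by at most r/n^2 \<le> 1; this
    loss is the factor \<open>exp 1\<close>.\<close>
  have "ln (1 + 1 / n) \<ge> 1 / n - (1 / n)\<^sup>2"
    using n by (intro ln_one_plus_pos_lower_bound) auto
  then have "r * ln (1 + 1 / n) \<ge> r * (1 / n - (1 / n)\<^sup>2)"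
    using r by (intro mult_left_mono) auto
  moreover have "r * (1 / n - (1 / n)\<^sup>2) = r / n - r / (real n)\<^sup>2"
    by (simp add: power2_eq_square right_diff_distrib)
  moreover have "r / (real n)\<^sup>2 \<le> 1" using r n0 by simp
  ultimately have l: "- (r * ln (1 + 1 / n)) \<le> 1 + - r / n" by simp
  have "(1 + 1 / n) powr (- (r + 1)) \<le> (1 + 1 / n) powr (- r)"
    by (intro powr_mono) auto
  also have "\<dots> = exp (- (r * ln (1 + 1 / n)))"
    using n0 add_pos_pos[of 1 "1 / real n"] by (simp add: powr_def)
  also have "\<dots> \<le> exp (1 + - r / n)" using l by (simp only: exp_le_cancel_iff)
  finally have P1: "(1 + 1 / n) powr (- (r + 1)) \<le> exp 1 * exp (- r / n)"
    by (simp only: exp_add)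
  \<comment> \<open>Bernoulli is applied with exponent (r + 1)/4, which is at least 1 because r
    \<ge> n + 1 \<ge> 3. The fourth power then gives j^4, at the price 4^4 = 256.\<close>
  have "real j / 4 \<le> 1 + (real j - 1) / 4" by (simp add: diff_divide_distrib)
  also have "\<dots> \<le> 1 + (r + 1) / 4 * y"
  proof -
    have "(real j - 1) * (real n + 1) \<le> (real j - 1) * (r + 1)"
      using r j by (intro mult_left_mono) auto
    then show ?thesis
      unfolding y_def using n0 by (simp add: field_simps)
  qed
  also have "\<dots> \<le> (1 + y) powr ((r + 1) / 4)"
    using r n y0 by (intro Bernoulli_inequality_powr) auto
  finally have "(real j / 4) ^ 4 \<le> ((1 + y) powr ((r + 1) / 4)) ^ 4"
    by (intro power_mono) auto
  also have "\<dots> = (1 + y) powr (r + 1)"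
    using y0 by (simp add: powr_power add_divide_distrib)
  finally have J: "(real j / 4) ^ 4 \<le> (1 + y) powr (r + 1)" .
  have "(1 + y) powr (- (r + 1)) = 1 / (1 + y) powr (r + 1)"
    using powr_minus_divide[of "1 + y" "r + 1"] by simp
  also have "\<dots> \<le> 1 / (real j / 4) ^ 4"
    using J j by (intro divide_left_mono mult_pos_pos) (auto intro: order_less_le_trans)
  also have "\<dots> = 256 / real j ^ 4" by (simp add: power_divide)
  finally have P2: "(1 + y) powr (- (r + 1)) \<le> 256 / real j ^ 4" .
  have "(1 + j / n) powr (- (r + 1)) = (1 + 1 / n) powr (- (r + 1)) * (1 + y) powr (- (r + 1))"
    unfolding split by (rule powr_mult)
  also have "\<dots> \<le> (exp 1 * exp (- r / n)) * (256 / real j ^ 4)"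
    using P1 P2 by (intro mult_mono) auto
  finally show ?thesis by (simp add: mult_ac)
qed

section \<open>The geometric kernel and the passage from the tail to the step kernel\<close>

definition geom :: "real \<Rightarrow> real \<Rightarrow> complex" where
  "geom q t = 1 / (1 - of_real q * cis t)"

lemma geom_sums:
  assumes "\<bar>q\<bar> < 1"
  shows "(\<lambda>k. q ^ k * cos (real (n + k) * t - b)) sums Re (cis (real n * t - b) * geom q t)"
proof -
  have "(\<lambda>k. (of_real q * cis t) ^ k) sums geom q t"
    unfolding geom_def using assms by (intro geometric_sums) (simp add: norm_mult)
  then have "(\<lambda>k. cis (real n * t - b) * (of_real q * cis t) ^ k) sums (cis (real n * t - b) * geom q t)"
    by (rule sums_mult)
  then have "(\<lambda>k. Re (cis (real n * t - b) * (of_real q * cis t) ^ k)) sums Re (cis (real n * t - b) * geom q t)"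
    by (simp only: sums_complex_iff)
  moreover have "Re (cis (real n * t - b) * (of_real q * cis t) ^ k) = q ^ k * cos (real (n + k) * t - b)" for k
  proof -
    have "cis (real n * t - b) * (of_real q * cis t) ^ k = of_real (q ^ k) * (cis (real n * t - b) * cis (real k * t))"
      by (simp add: power_mult_distrib Complex.DeMoivre mult_ac)
    also have "\<dots> = of_real (q ^ k) * cis (real (n + k) * t - b)"
      unfolding cis_mult by (simp add: algebra_simps)
    finally have "Re (cis (real n * t - b) * (of_real q * cis t) ^ k) = Re (of_real (q ^ k) * cis (real (n + k) * t - b))"
      by (rule arg_cong)
    then show ?thesis by simp
  qed
  ultimately show ?thesis by simp
qed

lemma norm_cis_diff_le: "norm (cis s - cis t) \<le> \<bar>s - t\<bar>"
proof (rule power2_le_imp_le)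
  have "(norm (cis s - cis t))\<^sup>2 = (cos s - cos t)\<^sup>2 + (sin s - sin t)\<^sup>2"
    by (simp add: cmod_power2)
  also have "\<dots> = (sin s ^ 2 + cos s ^ 2) + (sin t ^ 2 + cos t ^ 2) - 2 * (cos s * cos t + sin s * sin t)"
    by (simp add: power2_eq_square algebra_simps)
  also have "\<dots> = 2 - 2 * cos (s - t)" by (simp only: sin_cos_squared_add cos_diff)
  also have "\<dots> = 4 * (sin ((s - t) / 2))\<^sup>2"
  proof -
    have "cos (s - t) = 1 - 2 * (sin ((s - t) / 2))\<^sup>2"
      using cos_double_sin[of "(s - t) / 2"] by (metis field_sum_of_halves mult_2)
    then show ?thesis by simp
  qed
  also have "\<dots> \<le> 4 * ((s - t) / 2)\<^sup>2"
    using power_mono[OF abs_sin_x_le_abs_x[of "(s - t) / 2"], of 2] by (simp only: power2_abs abs_ge_zero) simp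
  also have "\<dots> = \<bar>s - t\<bar>\<^sup>2" by (simp add: power_divide)
  finally show "(norm (cis s - cis t))\<^sup>2 \<le> \<bar>s - t\<bar>\<^sup>2" .
qed simp

lemma one_minus_cis_bounds:
  assumes "0 \<le> q"
  shows "1 - q \<le> norm (1 - of_real q * cis t)" "norm (1 - of_real q * cis t) \<le> 1 + q"
  using norm_triangle_ineq2[of 1 "of_real q * cis t"] norm_triangle_ineq4[of 1 "of_real q * cis t"] assms
  by (auto simp: norm_mult)

lemma geom_norm_bounds:
  assumes "0 \<le> q" "q < 1"
  shows "norm (geom q t) \<le> 1 / (1 - q)" "1 / (1 + q) \<le> norm (geom q t)"
proof -
  have p: "norm (1 - of_real q * cis t) > 0"
    using one_minus_cis_bounds(1)[of q t] assms by linarith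
  then show "norm (geom q t) \<le> 1 / (1 - q)"
    using one_minus_cis_bounds[of q t] assms
    unfolding geom_def norm_divide norm_one by (intro divide_left_mono) auto
  show "1 / (1 + q) \<le> norm (geom q t)"
    using one_minus_cis_bounds[of q t] assms p
    unfolding geom_def norm_divide norm_one by (intro divide_left_mono) auto
qed

text \<open>The difference of the reciprocals is q (cis s - cis t) times both of them, each at most
  2. The factor \<open>q\<close> has to survive, since the admissible error is itself proportional
  to \<open>q\<close>.\<close>

lemma geom_diff_bound:
  assumes "0 \<le> q" "q \<le> 1 / 2"
  shows "norm (geom q s - geom q t) \<le> 4 * q * \<bar>s - t\<bar>"
proof -
  have nz: "1 - of_real q * cis u \<noteq> 0" for u
    using one_minus_cis_bounds(1)[of q u] assms by auto
  have "geom q s - geom q t = of_real q * (cis s - cis t) * (geom q s * geom q t)"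
    unfolding geom_def using nz[of s] nz[of t] by (simp add: divide_simps) (simp add: algebra_simps)
  then have "norm (geom q s - geom q t) = q * norm (cis s - cis t) * (norm (geom q s) * norm (geom q t))"
    using assms by (simp add: norm_mult)
  also have "\<dots> \<le> q * \<bar>s - t\<bar> * (2 * 2)"
  proof (intro mult_mono)
    have "1 / (1 - q) \<le> 2" using assms by (simp add: field_simps)
    then show "norm (geom q s) \<le> 2" "norm (geom q t) \<le> 2"
      using geom_norm_bounds(1)[of q s] geom_norm_bounds(1)[of q t] assms by linarith+
  qed (use assms norm_cis_diff_le in auto)
  finally show ?thesis by (simp add: mult_ac)
qed

text \<open>
  Freezing the slowly varying factor on each cell leaves an exact full period of a cosine with
  constant amplitude and phase there.
\<close>

definition step_kernel :: "nat \<Rightarrow> real \<Rightarrow> real \<Rightarrow> real \<Rightarrow> real" where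
  "step_kernel n q b t = Re (cis (real n * t - b) * geom q (grid n t))"

text \<open>After scaling by n^r both sides are series in the same cosines, with coefficients (1 +
  j/n)^(-r) and q^j. The differences \<open>d j\<close> are nonnegative and vanish at j = 0, so
  their sum bounds the error for all \<open>t\<close> and \<open>b\<close>.\<close>

lemma kernel_tail_geom:
  fixes n :: nat and r :: real
  assumes n: "n \<ge> 2" and r: "real n + 1 \<le> r" "r \<le> (real n)\<^sup>2"
  defines "q \<equiv> exp (- r / n)"
  shows "\<bar>real n powr r * kernel_tail n r b t - Re (cis (real n * t - b) * geom q t)\<bar>
    \<le> 256 * exp 1 * (pi\<^sup>2 / 6) * (r * real n powr (- 2) * q)"
proof -
  have n0: "real n > 0" using n by simp
  have q: "0 < q" "q < 1" using r n by (auto simp: q_def)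
  have r1: "r > 1" using r n by simp
  define d where "d j = (1 + real j / n) powr (- r) - q ^ j" for j
  have qj: "q ^ j = exp (- r * (real j / n))" for j
    by (simp add: q_def exp_of_nat_mult[symmetric] mult_ac)
  have coeff: "real n powr r * real (n + j) powr (- r) = (1 + real j / n) powr (- r)" for j
  proof -
    have "1 + real j / n = real (n + j) / real n" using n0 by (simp add: field_simps)
    then show ?thesis using n0 by (simp add: powr_divide powr_minus field_simps)
  qed
  define D where "D = 256 * exp 1 * (r * real n powr (- 2) * q)"
  have D0: "D \<ge> 0" using r1 q by (simp add: D_def)
  have dpos: "0 \<le> d j" for j
    unfolding d_def qj using one_plus_powr_minus_exp(1)[of "real j / n" r] r1 by simp
  have d0: "d 0 = 0" using n0 by (simp add: d_def)
  have dS: "d (Suc i) \<le> D * (1 / (real i + 1)\<^sup>2)" for i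
  proof -
    let ?j = "Suc i"
    have "d ?j \<le> r * (real ?j / n)\<^sup>2 * (1 + real ?j / n) powr (- (r + 1))"
      unfolding d_def qj using r1 by (intro one_plus_powr_minus_exp(2)) auto
    also have "\<dots> \<le> r * (real ?j / n)\<^sup>2 * (256 * exp 1 * exp (- r / n) / real ?j ^ 4)"
      using r1 tail_coefficient_bound[OF n r, of ?j] by (intro mult_left_mono) auto
    \<comment> \<open>The square (j/n)^2 supplies n^(-2) and consumes half of the decay j^(-4); what
      remains, 1/j^2, sums to pi^2/6.\<close>
    also have "\<dots> = D * (1 / (real ?j)\<^sup>2)"
    proof -
      have "real n powr (- 2) = 1 / (real n)\<^sup>2"
        using n0 powr_minus_divide[of "real n" 2] powr_realpow[OF n0, of 2] by simp
      moreover have "real ?j ^ 4 = (real ?j)\<^sup>2 * (real ?j)\<^sup>2" by (simp add: power2_eq_square power4_eq_xxxx)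
      moreover have "(real ?j)\<^sup>2 \<noteq> 0" by simp
      ultimately show ?thesis
        unfolding D_def q_def[symmetric] using n0 by (simp only: power_divide) (simp add: divide_simps)
    qed
    finally show ?thesis by (simp add: add.commute)
  qed
  have sq: "(\<lambda>i. D * (1 / (real i + 1)\<^sup>2)) sums (D * (pi\<^sup>2 / 6))"
    by (intro sums_mult) (use inverse_squares_sums in \<open>simp add: add.commute\<close>)
  have smS: "summable (\<lambda>i. d (Suc i))"
    by (rule summable_comparison_test[OF _ sums_summable[OF sq]]) (use dS dpos in auto)
  then have smd: "summable d" by (simp only: summable_Suc_iff)
  have "suminf d = (\<Sum>i. d (Suc i))" using suminf_split_head[OF smd] d0 by simp
  also have "\<dots> \<le> D * (pi\<^sup>2 / 6)"
    using sums_le[OF dS summable_sums[OF smS] sq] .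
  finally have sumd: "suminf d \<le> D * (pi\<^sup>2 / 6)" .
  have tail: "(\<lambda>k. (1 + real k / n) powr (- r) * cos (real (n + k) * t - b)) sums
      (real n powr r * kernel_tail n r b t)"
  proof -
    have "summable (\<lambda>k. real (n + k) powr (- r) * cos (real (n + k) * t - b))"
    proof (rule summable_comparison_test)
      show "summable (\<lambda>k. real (n + k) powr (- r))"
        using summable_powr_shift[OF r1, of n] by (simp add: add.commute)
      show "\<exists>N. \<forall>k\<ge>N. norm (real (n + k) powr (- r) * cos (real (n + k) * t - b)) \<le> real (n + k) powr (- r)"
        by (auto simp: abs_mult intro!: mult_left_le)
    qed
    then have "(\<lambda>k. real n powr r * (real (n + k) powr (- r) * cos (real (n + k) * t - b))) sums
        (real n powr r * kernel_tail n r b t)"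
      unfolding kernel_tail_def by (intro sums_mult summable_sums)
    then show ?thesis by (simp only: mult.assoc[symmetric] coeff)
  qed
  have "(\<lambda>k. (1 + real k / n) powr (- r) * cos (real (n + k) * t - b) - q ^ k * cos (real (n + k) * t - b)) sums
      (real n powr r * kernel_tail n r b t - Re (cis (real n * t - b) * geom q t))"
    using q by (intro sums_diff tail geom_sums) auto
  then have eq: "real n powr r * kernel_tail n r b t - Re (cis (real n * t - b) * geom q t)
      = (\<Sum>k. d k * cos (real (n + k) * t - b))"
    unfolding d_def by (simp add: sums_iff left_diff_distrib)
  have "norm (\<Sum>k. d k * cos (real (n + k) * t - b)) \<le> suminf d"
    by (rule norm_suminf_le[OF _ smd]) (use dpos in \<open>auto simp: abs_mult intro!: mult_left_le\<close>)
  then show ?thesis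
    using sumd unfolding eq by (simp add: D_def mult_ac)
qed

text \<open>Since r/n \<ge> 1, q stays away from 1, and every bound on \<open>geom\<close> becomes
  an absolute constant.\<close>

lemma exp_minus_quotient_bounds:
  assumes "n \<ge> 2" "real n + 1 \<le> r"
  shows "0 < exp (- r / real n)" "exp (- r / real n) \<le> 1 / 2"
proof -
  have "r / n \<ge> 1" using assms by simp
  then have "2 \<le> exp (r / n)" using exp_ge_add_one_self[of "r / n"] by linarith
  then have "1 / exp (r / n) \<le> 1 / 2" by (intro divide_left_mono) auto
  then show "exp (- r / real n) \<le> 1 / 2" by (simp add: exp_minus inverse_eq_divide)
qed simp

lemma kernel_tail_approx:
  fixes n :: nat and r :: real
  assumes n: "n \<ge> 2" and r: "real n + 1 \<le> r" "r \<le> (real n)\<^sup>2"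
  defines "q \<equiv> exp (- r / n)"
  shows "\<bar>real n powr r * kernel_tail n r b t - step_kernel n q b t\<bar>
    \<le> (256 * exp 1 * (pi\<^sup>2 / 6) + 8 * pi) * (r * real n powr (- 2) * q)"
proof -
  have n0: "real n > 0" using n by simp
  have q: "0 \<le> q" "q \<le> 1 / 2"
    using exp_minus_quotient_bounds[OF n r(1)] by (simp_all add: q_def)
  have "\<bar>Re (cis (real n * t - b) * geom q t) - step_kernel n q b t\<bar>
      = \<bar>Re (cis (real n * t - b) * (geom q t - geom q (grid n t)))\<bar>"
    by (simp add: step_kernel_def algebra_simps)
  also have "\<dots> \<le> norm (geom q t - geom q (grid n t))"
    using abs_Re_le_cmod[of "cis (real n * t - b) * (geom q t - geom q (grid n t))"] by (simp add: norm_mult)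
  also have "\<dots> \<le> 4 * q * \<bar>t - grid n t\<bar>" by (rule geom_diff_bound[OF q])
  also have "\<dots> \<le> 4 * q * (2 * pi / n)"
    using grid_bounds[of n t] n q by (intro mult_left_mono) auto
  also have "\<dots> \<le> 8 * pi * (r * real n powr (- 2) * q)"
  proof -
    have p2: "real n powr (- 2) = 1 / (real n)\<^sup>2"
      using n0 powr_minus_divide[of "real n" 2] powr_realpow[OF n0, of 2] by simp
    \<comment> \<open>The lower bound on \<open>r\<close> enters here: freezing costs q/n, which r
      \<ge> n places below r n^(-2) q.\<close>
    have "1 / n \<le> r * real n powr (- 2)"
      unfolding p2 using r n0 by (simp add: field_simps power2_eq_square)
    then have "8 * pi * q * (1 / n) \<le> 8 * pi * q * (r * real n powr (- 2))"
      using q by (intro mult_left_mono) auto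
    then show ?thesis by (simp add: mult_ac)
  qed
  finally have "\<bar>Re (cis (real n * t - b) * geom q t) - step_kernel n q b t\<bar>
      \<le> 8 * pi * (r * real n powr (- 2) * q)" .
  with kernel_tail_geom[OF n r, of b t] show ?thesis
    unfolding q_def[symmetric] distrib_right by linarith
qed

section \<open>Powers of the geometric kernel and the hypergeometric value\<close>

lemma norm_powr_of_real: "z \<noteq> 0 \<Longrightarrow> norm (z powr (of_real a :: complex)) = norm z powr a"
  by (simp add: powr_def Re_Ln)

text \<open>The integrand is the squared modulus of a binomial series with real coefficients
  \<open>c k\<close>. Its real part \<open>C\<close> and imaginary part \<open>S\<close> are treated
  separately, each square being integrated by expanding only one of its two factors.\<close>

lemma geom_powr_integral:
  assumes q: "0 \<le> q" "q < 1"
  shows "(LINT t:{-pi..pi}|lebesgue. norm (geom q t) powr s) = 2 * pi * hypergeom (s / 2) (s / 2) 1 (q\<^sup>2)"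
proof -
  define a where "a = s / 2"
  define c where "c k = pochhammer a k / fact k * q ^ k" for k
  have bin: "(\<lambda>k. of_real (c k) * cis (real k * t)) sums ((1 - of_real q * cis t) powr of_real (- a))" for t
  proof -
    have "(\<lambda>k. (of_real (- a) gchoose k) * (- (of_real q * cis t)) ^ k) sums
        ((1 + - (of_real q * cis t)) powr of_real (- a))"
      by (rule gen_binomial_complex) (use q in \<open>simp add: norm_mult\<close>)
    moreover have "(of_real (- a) gchoose k) * (- (of_real q * cis t)) ^ k = of_real (c k) * cis (real k * t)" for k
    proof -
      have p: "pochhammer (complex_of_real a) k = of_real (pochhammer a k)" by (rule pochhammer_of_real)
      have "(of_real (- a) gchoose k) = (-1) ^ k * of_real (pochhammer a k) / (fact k :: complex)"
        using gbinomial_pochhammer[of "complex_of_real (- a)" k] p by simp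
      moreover have "(- (of_real q * cis t)) ^ k = (-1) ^ k * (of_real (q ^ k) * cis (real k * t))"
        by (subst power_minus) (simp add: power_mult_distrib Complex.DeMoivre)
      moreover have "(-1) ^ k * ((-1) ^ k :: complex) = 1"
        by (simp flip: power_mult_distrib)
      ultimately show ?thesis by (simp add: c_def mult_ac)
    qed
    ultimately show ?thesis by simp
  qed
  have csum: "summable (\<lambda>k. \<bar>c k\<bar>)"
  proof -
    \<comment> \<open>Convergence at a radius strictly between \<open>q\<close> and 1 yields
      absolute convergence at \<open>q\<close>.\<close>
    define q' where "q' = (1 + q) / 2"
    have q': "q < q'" "q' < 1" "q' > 0" using q by (auto simp: q'_def)
    have "(\<lambda>k. (- a gchoose k) * (- q') ^ k) sums (1 + - q') powr (- a)"
      by (rule gen_binomial_real) (use q' in auto)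
    then have "summable (\<lambda>k. (- a gchoose k) * (- q') ^ k)" by (rule sums_summable)
    then have "summable (\<lambda>k. norm ((- a gchoose k) * q ^ k))"
      by (rule powser_insidea) (use q q' in auto)
    moreover have "norm ((- a gchoose k) * q ^ k) = \<bar>c k\<bar>" for k
      using q by (simp add: c_def gbinomial_pochhammer abs_mult power_abs)
    ultimately show ?thesis by simp
  qed
  \<comment> \<open>No sign of \<open>s\<close> is assumed, so \<open>c k\<close> may be negative;
    its sign moves into the functions to leave nonnegative coefficients.\<close>
  define C where "C t = (\<Sum>k. \<bar>c k\<bar> * (sgn (c k) * cos (real k * t)))" for t
  define S where "S t = (\<Sum>k. \<bar>c k\<bar> * (sgn (c k) * sin (real k * t)))" for t
  have sg: "\<bar>c k\<bar> * (sgn (c k) * x) = c k * x" for k x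
    using abs_mult_sgn[of "c k"] by (simp add: mult.assoc[symmetric])
  have CS: "(norm (geom q t) powr s) = C t * C t + S t * S t" for t
  proof -
    let ?z = "1 - of_real q * cis t" and ?w = "(1 - of_real q * cis t) powr (of_real (- a))"
    have z: "norm ?z > 0" using one_minus_cis_bounds(1)[of q t] q by linarith
    have "norm (geom q t) powr s = norm ?z powr (- s)"
      using z by (simp add: geom_def norm_divide powr_minus powr_divide field_simps)
    also have "\<dots> = (norm ?z powr (- a))\<^sup>2"
      using z by (simp add: a_def power2_eq_square flip: powr_add)
    also have "\<dots> = (norm ?w)\<^sup>2"
      using z by (subst norm_powr_of_real) auto
    also have "\<dots> = (Re ?w)\<^sup>2 + (Im ?w)\<^sup>2" by (rule cmod_power2)
    also have "Re ?w = C t"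
      using bin[of t] unfolding sums_complex_iff C_def sg by (simp add: sums_iff)
    also have "Im ?w = S t"
      using bin[of t] unfolding sums_complex_iff S_def sg by (simp add: sums_iff)
    finally show ?thesis by (simp add: power2_eq_square)
  qed
  have bdc: "\<bar>sgn (c k) * cos (real k * t)\<bar> \<le> 1" and bds: "\<bar>sgn (c k) * sin (real k * t)\<bar> \<le> 1" for k t
    by (auto simp: abs_mult sgn_real_def)
  have mc: "(\<lambda>t. sgn (c k) * cos (real k * t)) \<in> borel_measurable borel"
    and ms: "(\<lambda>t. sgn (c k) * sin (real k * t)) \<in> borel_measurable borel" for k
    by measurable
  note serC = set_integral_weighted_series[where g = "\<lambda>k t. sgn (c k) * cos (real k * t)", OF _ mc bdc csum abs_ge_zero, folded C_def]
  note serS = set_integral_weighted_series[where g = "\<lambda>k t. sgn (c k) * sin (real k * t)", OF _ ms bds csum abs_ge_zero, folded S_def]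
  have one: "set_integrable lebesgue {-pi..pi} (\<lambda>t. 1::real)"
    by (rule absolutely_integrable_on_const) auto
  have IC: "set_integrable lebesgue {-pi..pi} C" using serC(1)[OF one] by simp
  have IS: "set_integrable lebesgue {-pi..pi} S" using serS(1)[OF one] by simp
  have coefC: "(LINT t:{-pi..pi}|lebesgue. cos (real k * t) * C t) = c k * (if k = 0 then 2 * pi else pi)" for k
  proof -
    have "set_integrable lebesgue {-pi..pi} (\<lambda>t. cos (real k * t))"
      by (intro absolutely_integrable_continuous_real continuous_intros)
    note s = serC(2)[OF this]
    have "\<bar>c j\<bar> * (LINT t:{-pi..pi}|lebesgue. cos (real k * t) * (sgn (c j) * cos (real j * t)))
        = (if j = k then c j * (if j = 0 then 2 * pi else pi) else 0)" for j
    proof -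
      have "(LINT t:{-pi..pi}|lebesgue. cos (real k * t) * (sgn (c j) * cos (real j * t)))
          = sgn (c j) * (LINT t:{-pi..pi}|lebesgue. cos (real k * t) * cos (real j * t))"
        by (subst set_integral_mult_right[symmetric]) (simp add: mult_ac)
      then show ?thesis unfolding trig_orthogonality by (simp add: sg)
    qed
    with s have "(\<lambda>j. if j = k then c j * (if j = 0 then 2 * pi else pi) else 0) sums
        (LINT t:{-pi..pi}|lebesgue. cos (real k * t) * C t)" by simp
    then show ?thesis
      using sums_unique2[OF _ sums_single[of k "\<lambda>j. c j * (if j = 0 then 2 * pi else pi)"]] by simp
  qed
  have coefS: "(LINT t:{-pi..pi}|lebesgue. sin (real k * t) * S t) = c k * (if k = 0 then 0 else pi)" for k
  proof -
    have "set_integrable lebesgue {-pi..pi} (\<lambda>t. sin (real k * t))"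
      by (intro absolutely_integrable_continuous_real continuous_intros)
    note s = serS(2)[OF this]
    have "\<bar>c j\<bar> * (LINT t:{-pi..pi}|lebesgue. sin (real k * t) * (sgn (c j) * sin (real j * t)))
        = (if j = k then c j * (if j = 0 then 0 else pi) else 0)" for j
    proof -
      have "(LINT t:{-pi..pi}|lebesgue. sin (real k * t) * (sgn (c j) * sin (real j * t)))
          = sgn (c j) * (LINT t:{-pi..pi}|lebesgue. sin (real k * t) * sin (real j * t))"
        by (subst set_integral_mult_right[symmetric]) (simp add: mult_ac)
      then show ?thesis unfolding trig_orthogonality by (simp add: sg)
    qed
    with s have "(\<lambda>j. if j = k then c j * (if j = 0 then 0 else pi) else 0) sums
        (LINT t:{-pi..pi}|lebesgue. sin (real k * t) * S t)" by simp
    then show ?thesis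
      using sums_unique2[OF _ sums_single[of k "\<lambda>j. c j * (if j = 0 then 0 else pi)"]] by simp
  qed
  have CC: "(\<lambda>k. c k * (c k * (if k = 0 then 2 * pi else pi))) sums (LINT t:{-pi..pi}|lebesgue. C t * C t)"
  proof -
    have "\<bar>c k\<bar> * (LINT t:{-pi..pi}|lebesgue. C t * (sgn (c k) * cos (real k * t)))
        = c k * (c k * (if k = 0 then 2 * pi else pi))" for k
    proof -
      have "(LINT t:{-pi..pi}|lebesgue. C t * (sgn (c k) * cos (real k * t)))
          = sgn (c k) * (LINT t:{-pi..pi}|lebesgue. cos (real k * t) * C t)"
        by (subst set_integral_mult_right[symmetric]) (simp add: mult_ac)
      then show ?thesis unfolding coefC by (simp only: sg)
    qed
    then show ?thesis using serC(2)[OF IC] by (simp only:)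
  qed
  have SS: "(\<lambda>k. c k * (c k * (if k = 0 then 0 else pi))) sums (LINT t:{-pi..pi}|lebesgue. S t * S t)"
  proof -
    have "\<bar>c k\<bar> * (LINT t:{-pi..pi}|lebesgue. S t * (sgn (c k) * sin (real k * t)))
        = c k * (c k * (if k = 0 then 0 else pi))" for k
    proof -
      have "(LINT t:{-pi..pi}|lebesgue. S t * (sgn (c k) * sin (real k * t)))
          = sgn (c k) * (LINT t:{-pi..pi}|lebesgue. sin (real k * t) * S t)"
        by (subst set_integral_mult_right[symmetric]) (simp add: mult_ac)
      then show ?thesis unfolding coefS by (simp only: sg)
    qed
    then show ?thesis using serS(2)[OF IS] by (simp only:)
  qed
  have "(LINT t:{-pi..pi}|lebesgue. norm (geom q t) powr s)
      = (LINT t:{-pi..pi}|lebesgue. C t * C t) + (LINT t:{-pi..pi}|lebesgue. S t * S t)"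
    unfolding CS by (intro set_integral_add(2)) (use serC(1)[OF IC] serS(1)[OF IS] in auto)
  moreover have "(\<lambda>k. 2 * pi * (c k)\<^sup>2) sums
      ((LINT t:{-pi..pi}|lebesgue. C t * C t) + (LINT t:{-pi..pi}|lebesgue. S t * S t))"
  proof -
    \<comment> \<open>The constant term contributes 2 pi through \<open>C\<close> alone, every other
      harmonic pi through each of \<open>C\<close> and \<open>S\<close>.\<close>
    have e: "c k * (c k * (if k = 0 then 2 * pi else pi)) + c k * (c k * (if k = 0 then 0 else pi)) = 2 * pi * (c k)\<^sup>2" for k
      by (simp add: power2_eq_square)
    show ?thesis using sums_add[OF CC SS] unfolding e .
  qed
  ultimately have P: "(\<lambda>k. 2 * pi * (c k)\<^sup>2) sums (LINT t:{-pi..pi}|lebesgue. norm (geom q t) powr s)"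
    by simp
  then have P': "(\<lambda>k. (c k)\<^sup>2) sums ((LINT t:{-pi..pi}|lebesgue. norm (geom q t) powr s) / (2 * pi))"
    using sums_divide[OF P, of "2 * pi"] by simp
  \<comment> \<open>\<open>pochhammer 1 (Suc k)\<close> is a second factorial, so the hypergeometric
    term is a perfect square.\<close>
  have c2: "pochhammer (s / 2) (Suc k) * pochhammer (s / 2) (Suc k) / pochhammer 1 (Suc k) *
     ((q\<^sup>2) ^ Suc k / fact (Suc k)) = (c (Suc k))\<^sup>2" for k
    by (simp add: c_def a_def pochhammer_fact[symmetric] power2_eq_square power_mult_distrib field_simps del: power_Suc fact_Suc)
  have "hypergeom (s / 2) (s / 2) 1 (q\<^sup>2) = (c 0)\<^sup>2 + (\<Sum>k. (c (Suc k))\<^sup>2)"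
    unfolding hypergeom_def c2 by (simp add: c_def)
  also have "\<dots> = (\<Sum>k. (c k)\<^sup>2)"
    using suminf_split_head[OF sums_summable[OF P']] by simp
  also have "\<dots> = (LINT t:{-pi..pi}|lebesgue. norm (geom q t) powr s) / (2 * pi)"
    using sums_unique[OF P'] by simp
  finally show ?thesis by simp
qed

section \<open>The balls of \<open>L\<^sub>p\<close> and duality\<close>

lemma set_integral_one_period: "(LINT t:{-pi..pi}|lebesgue. 1) = 2 * pi"
  using trig_integral(1)[of 0] by simp

lemma set_integrable_const_period: "set_integrable lebesgue {-pi..pi} (\<lambda>t. c :: real)"
  by (rule absolutely_integrable_on_const) auto

lemma set_integral_pos:
  fixes f :: "real \<Rightarrow> real"
  assumes f: "set_integrable lebesgue {-pi..pi} f" "\<And>t. f t \<ge> 0"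
    and uv: "-pi \<le> u" "u < v" "v \<le> pi" and c: "c > 0" "\<And>t. t \<in> {u..v} \<Longrightarrow> c \<le> f t"
  shows "(LINT t:{-pi..pi}|lebesgue. f t) > 0"
proof -
  have "0 < c * (v - u)" using uv c by simp
  also have "\<dots> = (LINT t:{-pi..pi}|lebesgue. c * indicator {u..v} t)"
  proof -
    have ind: "indicator {-pi..pi} t *\<^sub>R (c * indicator {u..v} t) = c * indicator {u..v} t" for t
      using uv by (auto simp: indicator_def)
    show ?thesis using uv unfolding set_lebesgue_integral_def ind by simp
  qed
  also have "\<dots> \<le> (LINT t:{-pi..pi}|lebesgue. f t)"
  proof (rule set_integral_mono[OF _ f(1)])
    show "set_integrable lebesgue {-pi..pi} (\<lambda>t. c * indicator {u..v} t)"
    proof (rule set_integrable_bounded_interval[where M = c])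
      show "(\<lambda>t. c * indicator {u..v} t) \<in> borel_measurable lebesgue"
        by (intro borel_measurable_times borel_measurable_const borel_measurable_indicator) auto
    qed (use c(1) in \<open>auto simp: indicator_def\<close>)
    show "c * indicator {u..v} t \<le> f t" for t
      using f(2) c by (auto simp: indicator_def)
  qed
  finally show ?thesis .
qed

text \<open>Passes from extended to real arithmetic once and for all. The value s = 0 is excluded
  because 1/0 is infinite in \<open>ereal\<close>.\<close>

lemma conjugate_exponent_cases:
  assumes "1 < p" "1 / p + 1 / ereal s = 1"
  obtains "p = \<infinity>" "s = 1" | p0 where "p = ereal p0" "p0 > 1" "s > 1" "1 / p0 + 1 / s = 1"
proof (cases p)
  case (real p0)
  have p0: "p0 > 1" using assms(1) real by (simp add: one_ereal_def)
  have s0: "s \<noteq> 0" using assms(2) real p0 by (auto simp: one_ereal_def)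
  have e: "1 / p0 + 1 / s = 1" using assms(2) real p0 s0 by (simp add: one_ereal_def)
  have "0 < 1 / p0" "1 / p0 < 1" using p0 by auto
  with e have "0 < 1 / s" "1 / s < 1" by linarith+
  then have "s > 1" by (simp add: divide_less_eq_1 zero_less_divide_iff)
  then show ?thesis using that(2)[OF real p0 _ e] by simp
next
  case PInf
  then have "s = 1" using assms(2) by (cases "s = 0") (auto simp: one_ereal_def)
  then show ?thesis using that(1) PInf by simp
qed (use assms in auto)

lemma Lp_ball0_infinity_AE:
  assumes "\<phi> \<in> Lp_ball0 \<infinity>"
  shows "AE t in lebesgue. \<bar>\<phi> t\<bar> \<le> 1"
proof -
  let ?e = "esssup lebesgue (\<lambda>t. ereal \<bar>\<phi> t\<bar>)"
  have "?e < \<infinity>" "real_of_ereal ?e \<le> 1"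
    using assms by (auto simp: Lp_ball0_def Lp_space_def Lp_norm_def)
  then have "?e \<le> ereal 1" by (cases ?e) auto
  with esssup_AE[of "\<lambda>t. ereal \<bar>\<phi> t\<bar>" lebesgue] show ?thesis
    by (auto elim!: eventually_mono) (metis ereal_less_eq(3) order_trans one_ereal_def)
qed

lemma Lp_ball0_finite:
  assumes "\<phi> \<in> Lp_ball0 (ereal p)" "p \<ge> 1"
  shows "set_integrable lebesgue {-pi..pi} (\<lambda>t. \<bar>\<phi> t\<bar> powr p)"
    and "(LINT t:{-pi..pi}|lebesgue. \<bar>\<phi> t\<bar> powr p) \<le> 1"
proof -
  let ?I = "LINT t:{-pi..pi}|lebesgue. \<bar>\<phi> t\<bar> powr p"
  show "set_integrable lebesgue {-pi..pi} (\<lambda>t. \<bar>\<phi> t\<bar> powr p)"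
    using assms by (auto simp: Lp_ball0_def Lp_space_def)
  have "?I powr (1 / p) \<le> 1" using assms by (auto simp: Lp_ball0_def Lp_norm_def)
  moreover have "0 < 1 / p" using assms(2) by simp
  ultimately show "?I \<le> 1" using gr_one_powr[of ?I "1 / p"] by linarith
qed

text \<open>From x \<le> 1 + x^p for x \<ge> 0 and p \<ge> 1. The bound is crude but independent of
  \<open>p\<close>, which makes the final constant absolute.\<close>

lemma Lp_ball0_L1:
  assumes "\<phi> \<in> Lp_ball0 p" "1 \<le> p"
  shows "set_integrable lebesgue {-pi..pi} \<phi>"
    and "(LINT t:{-pi..pi}|lebesgue. \<bar>\<phi> t\<bar>) \<le> 2 * pi + 1"
proof -
  have meas: "\<phi> \<in> borel_measurable lebesgue"
    using assms by (auto simp: Lp_ball0_def Lp_space_def)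
  have smeas: "set_borel_measurable lebesgue {-pi..pi} \<phi>"
    using meas unfolding set_borel_measurable_def
    by (intro borel_measurable_scaleR borel_measurable_indicator) auto
  note one = set_integrable_const_period[of 1]
  have "set_integrable lebesgue {-pi..pi} \<phi> \<and> (LINT t:{-pi..pi}|lebesgue. \<bar>\<phi> t\<bar>) \<le> 2 * pi + 1"
  proof (cases "p = \<infinity>")
    case True
    have AE: "AE t in lebesgue. \<bar>\<phi> t\<bar> \<le> 1"
      using assms True Lp_ball0_infinity_AE by simp
    have I: "set_integrable lebesgue {-pi..pi} \<phi>"
      by (rule set_integrable_bound[OF one smeas]) (use AE in \<open>auto elim: eventually_mono\<close>)
    have "(LINT t:{-pi..pi}|lebesgue. \<bar>\<phi> t\<bar>) \<le> (LINT t:{-pi..pi}|lebesgue. 1)"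
      by (rule set_integral_mono_AE[OF set_integrable_abs[OF I] one]) (use AE in \<open>auto elim: eventually_mono\<close>)
    then show ?thesis using I unfolding set_integral_one_period by simp
  next
    case False
    then obtain p0 where p0: "p = ereal p0" "p0 \<ge> 1"
      using assms(2) by (cases p) (auto simp: one_ereal_def)
    note fin = Lp_ball0_finite[OF assms(1)[unfolded p0] p0(2)]
    have le: "\<bar>\<phi> t\<bar> \<le> 1 + \<bar>\<phi> t\<bar> powr p0" for t
    proof (cases "\<bar>\<phi> t\<bar> \<le> 1")
      case False
      then have "\<bar>\<phi> t\<bar> powr 1 \<le> \<bar>\<phi> t\<bar> powr p0" using p0 by (intro powr_mono) auto
      then show ?thesis using False by simp
    qed (use powr_ge_zero[of "\<bar>\<phi> t\<bar>" p0] in linarith)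
    have S: "set_integrable lebesgue {-pi..pi} (\<lambda>t. 1 + \<bar>\<phi> t\<bar> powr p0)"
      by (intro set_integral_add(1) one fin)
    have I: "set_integrable lebesgue {-pi..pi} \<phi>"
      by (rule set_integrable_bound[OF S smeas]) (use le in \<open>auto intro!: AE_I2 order_trans[OF le]\<close>)
    have "(LINT t:{-pi..pi}|lebesgue. \<bar>\<phi> t\<bar>) \<le> (LINT t:{-pi..pi}|lebesgue. 1 + \<bar>\<phi> t\<bar> powr p0)"
      by (rule set_integral_mono[OF set_integrable_abs[OF I] S le])
    also have "\<dots> = 2 * pi + (LINT t:{-pi..pi}|lebesgue. \<bar>\<phi> t\<bar> powr p0)"
      using set_integral_add(2)[OF one fin(1)] set_integral_one_period by simp
    finally show ?thesis using I fin(2) by simp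
  qed
  then show "set_integrable lebesgue {-pi..pi} \<phi>"
    "(LINT t:{-pi..pi}|lebesgue. \<bar>\<phi> t\<bar>) \<le> 2 * pi + 1" by auto
qed

section \<open>Hoelder's inequality and its equality case\<close>

lemma set_integrable_mult_bounded:
  fixes \<phi> Q :: "real \<Rightarrow> real"
  assumes I: "set_integrable lebesgue {-pi..pi} \<phi>" 
    and Q: "Q \<in> borel_measurable lebesgue" "\<And>t. \<bar>Q t\<bar> \<le> M"
  shows "set_integrable lebesgue {-pi..pi} (\<lambda>t. \<phi> t * Q t)"
    and "\<bar>LINT t:{-pi..pi}|lebesgue. \<phi> t * Q t\<bar> \<le> M * (LINT t:{-pi..pi}|lebesgue. \<bar>\<phi> t\<bar>)"
proof -
  have MI: "set_integrable lebesgue {-pi..pi} (\<lambda>t. M * \<bar>\<phi> t\<bar>)"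
    using set_integrable_abs[OF I] by simp
  have le: "\<bar>\<phi> t * Q t\<bar> \<le> M * \<bar>\<phi> t\<bar>" for t
    using mult_right_mono[OF Q(2)[of t], of "\<bar>\<phi> t\<bar>"] by (simp add: abs_mult mult.commute)
  have "(\<lambda>t. indicator {-pi..pi} t *\<^sub>R \<phi> t) \<in> borel_measurable lebesgue"
    using I unfolding set_integrable_def by (rule borel_measurable_integrable)
  then have "(\<lambda>t. (indicator {-pi..pi} t *\<^sub>R \<phi> t) * Q t) \<in> borel_measurable lebesgue"
    using Q(1) by (rule borel_measurable_times)
  then have m: "set_borel_measurable lebesgue {-pi..pi} (\<lambda>t. \<phi> t * Q t)"
    unfolding set_borel_measurable_def by (simp add: mult.assoc)
  show J: "set_integrable lebesgue {-pi..pi} (\<lambda>t. \<phi> t * Q t)"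
    by (rule set_integrable_bound[OF MI m]) (auto intro!: AE_I2 order_trans[OF le])
  have "\<bar>LINT t:{-pi..pi}|lebesgue. \<phi> t * Q t\<bar> \<le> (LINT t:{-pi..pi}|lebesgue. \<bar>\<phi> t * Q t\<bar>)"
    using set_integral_norm_bound[OF J] by simp
  also have "\<dots> \<le> (LINT t:{-pi..pi}|lebesgue. M * \<bar>\<phi> t\<bar>)"
    by (rule set_integral_mono[OF set_integrable_abs[OF J] MI le])
  finally show "\<bar>LINT t:{-pi..pi}|lebesgue. \<phi> t * Q t\<bar> \<le> M * (LINT t:{-pi..pi}|lebesgue. \<bar>\<phi> t\<bar>)"
    by simp
qed

lemma set_integrable_powr_bounded:
  fixes Q :: "real \<Rightarrow> real"
  assumes "Q \<in> borel_measurable lebesgue" "\<And>t. \<bar>Q t\<bar> \<le> M" "s \<ge> 0"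
  shows "set_integrable lebesgue {-pi..pi} (\<lambda>t. \<bar>Q t\<bar> powr s)"
proof (rule set_integrable_bounded_interval[where M = "M powr s"])
  show "(\<lambda>t. \<bar>Q t\<bar> powr s) \<in> borel_measurable lebesgue"
    using assms(1) by (intro powr_real_measurable borel_measurable_abs) auto
  show "\<bar>\<bar>Q t\<bar> powr s\<bar> \<le> M powr s" for t
    using assms by (simp add: powr_mono2)
qed

text \<open>For finite exponents Young's inequality is integrated; for p = \<infinity> the bound
  \<bar>\<open>\<phi>\<close>\<bar> \<le> 1 almost everywhere suffices.\<close>

lemma Lp_ball0_pairing_le:
  fixes Q :: "real \<Rightarrow> real"
  assumes \<phi>: "\<phi> \<in> Lp_ball0 p" and p: "1 < p" "1 / p + 1 / ereal s = 1"
    and Q: "Q \<in> borel_measurable lebesgue" "\<And>t. \<bar>Q t\<bar> \<le> M"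
  defines "I \<equiv> (LINT t:{-pi..pi}|lebesgue. \<bar>Q t\<bar> powr s)"
  assumes I: "I > 0"
  shows "\<bar>LINT t:{-pi..pi}|lebesgue. \<phi> t * Q t\<bar> \<le> I powr (1 / s)"
proof -
  have int\<phi>: "set_integrable lebesgue {-pi..pi} \<phi>"
    by (rule Lp_ball0_L1(1)[OF \<phi>]) (use p in auto)
  note J = set_integrable_mult_bounded(1)[OF int\<phi> Q]
  have A: "\<bar>LINT t:{-pi..pi}|lebesgue. \<phi> t * Q t\<bar> \<le> (LINT t:{-pi..pi}|lebesgue. \<bar>\<phi> t * Q t\<bar>)"
    using set_integral_norm_bound[OF J] by simp
  from p show ?thesis
  proof (cases rule: conjugate_exponent_cases)
    case 1
    have QI: "set_integrable lebesgue {-pi..pi} (\<lambda>t. \<bar>Q t\<bar>)"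
      using set_integrable_powr_bounded[OF Q, of 1] by simp
    have "AE t in lebesgue. \<bar>\<phi> t * Q t\<bar> \<le> \<bar>Q t\<bar>"
      using Lp_ball0_infinity_AE[of \<phi>] \<phi> 1
      by (auto elim!: eventually_mono simp: abs_mult intro!: mult_left_le_one_le)
    then have "(LINT t:{-pi..pi}|lebesgue. \<bar>\<phi> t * Q t\<bar>) \<le> (LINT t:{-pi..pi}|lebesgue. \<bar>Q t\<bar>)"
      by (intro set_integral_mono_AE[OF set_integrable_abs[OF J] QI]) (auto elim: eventually_mono)
    then show ?thesis using A I 1 by (simp add: I_def)
  next
    case (2 p0)
    define N where "N = I powr (1 / s)"
    have N: "N > 0" using I by (simp add: N_def)
    have Ns: "N powr s = I" using I 2 by (simp add: N_def powr_powr)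
    note fin = Lp_ball0_finite[of \<phi> p0, OF \<phi>[unfolded 2(1)]]
    have fin': "set_integrable lebesgue {-pi..pi} (\<lambda>t. \<bar>\<phi> t\<bar> powr p0)"
      "(LINT t:{-pi..pi}|lebesgue. \<bar>\<phi> t\<bar> powr p0) \<le> 1"
      using fin 2 by auto
    note QI = set_integrable_powr_bounded[OF Q, of s]
    have RI: "set_integrable lebesgue {-pi..pi} (\<lambda>t. N / p0 * \<bar>\<phi> t\<bar> powr p0)"
      "set_integrable lebesgue {-pi..pi} (\<lambda>t. N / (s * I) * \<bar>Q t\<bar> powr s)"
      using fin' QI 2 by auto
    have le: "\<bar>\<phi> t * Q t\<bar> \<le> N / p0 * \<bar>\<phi> t\<bar> powr p0 + N / (s * I) * \<bar>Q t\<bar> powr s" for t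
    proof -
      \<comment> \<open>After division by the norm \<open>N\<close> the two terms integrate to at
        most 1/p0 and exactly 1/s, which add up to 1.\<close>
      have "\<bar>\<phi> t\<bar> * (\<bar>Q t\<bar> / N) \<le> \<bar>\<phi> t\<bar> powr p0 / p0 + (\<bar>Q t\<bar> / N) powr s / s"
        using 2 N by (intro Youngs_inequality) auto
      then have "N * (\<bar>\<phi> t\<bar> * (\<bar>Q t\<bar> / N)) \<le> N * (\<bar>\<phi> t\<bar> powr p0 / p0 + (\<bar>Q t\<bar> / N) powr s / s)"
        using N by (intro mult_left_mono) auto
      moreover have "(\<bar>Q t\<bar> / N) powr s = \<bar>Q t\<bar> powr s / I"
        using N Ns by (simp add: powr_divide)
      ultimately show ?thesis using N by (simp add: abs_mult distrib_left mult_ac)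
    qed
    have "(LINT t:{-pi..pi}|lebesgue. \<bar>\<phi> t * Q t\<bar>)
        \<le> (LINT t:{-pi..pi}|lebesgue. N / p0 * \<bar>\<phi> t\<bar> powr p0 + N / (s * I) * \<bar>Q t\<bar> powr s)"
      by (rule set_integral_mono[OF set_integrable_abs[OF J] set_integral_add(1)[OF RI] le])
    also have "\<dots> = (LINT t:{-pi..pi}|lebesgue. N / p0 * \<bar>\<phi> t\<bar> powr p0)
        + (LINT t:{-pi..pi}|lebesgue. N / (s * I) * \<bar>Q t\<bar> powr s)"
      by (rule set_integral_add(2)[OF RI])
    also have "\<dots> = N / p0 * (LINT t:{-pi..pi}|lebesgue. \<bar>\<phi> t\<bar> powr p0) + N / (s * I) * I"
      unfolding set_integral_mult_right I_def ..
    also have "\<dots> \<le> N / p0 * 1 + N / (s * I) * I"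
      using fin'(2) N 2 by (intro add_right_mono mult_left_mono) auto
    also have "\<dots> = N * (1 / p0 + 1 / s)" using I by (simp add: field_simps)
    finally show ?thesis using A 2 by (simp add: N_def)
  qed
qed

text \<open>Equality in Hoelder forces \<open>\<phi>\<close> to be a multiple of sgn Q
  \<bar>Q\<bar>^(s-1). The hypothesis \<open>mean\<close> says exactly that this multiple satisfies
  the mean-zero constraint, so nothing is lost against the unconstrained ball.\<close>

lemma Lp_ball0_extremal:
  fixes Q :: "real \<Rightarrow> real"
  assumes p: "1 < p" "1 / p + 1 / ereal s = 1"
    and Q: "Q \<in> borel_measurable lebesgue" "\<And>t. \<bar>Q t\<bar> \<le> M" "\<And>t. Q (t + 2 * pi) = Q t"
    and mean: "(LINT t:{-pi..pi}|lebesgue. sgn (Q t) * \<bar>Q t\<bar> powr (s - 1)) = 0"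
  defines "I \<equiv> (LINT t:{-pi..pi}|lebesgue. \<bar>Q t\<bar> powr s)"
  assumes I: "I > 0"
  shows "\<exists>\<phi>\<in>Lp_ball0 p. (LINT t:{-pi..pi}|lebesgue. \<phi> t * Q t) = I powr (1 / s)"
proof -
  have s: "s \<ge> 1" using p by (rule conjugate_exponent_cases) auto
  \<comment> \<open>Normalises the norm of \<open>\<phi>\<close>: for finite \<open>p0\<close> one
    has c^p0 = 1/I because p0 (1/s - 1) = -1, and for s = 1 simply c = 1.\<close>
  define c where "c = I powr (1 / s - 1)"
  have c: "c > 0" using I by (simp add: c_def)
  define \<phi> where "\<phi> t = c * (sgn (Q t) * \<bar>Q t\<bar> powr (s - 1))" for t
  have meas: "\<phi> \<in> borel_measurable lebesgue"
    unfolding \<phi>_def[abs_def] using Q(1)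
    by (intro borel_measurable_times borel_measurable_const borel_measurable_sgn powr_real_measurable borel_measurable_abs) auto
  have abs\<phi>: "\<bar>\<phi> t\<bar> = (if Q t = 0 then 0 else c * \<bar>Q t\<bar> powr (s - 1))" for t
    using c by (simp add: \<phi>_def abs_mult abs_sgn_eq)
  have per: "\<phi> (t + 2 * pi) = \<phi> t" for t by (simp add: \<phi>_def Q(3))
  have zero: "(LINT t:{-pi..pi}|lebesgue. \<phi> t) = 0" using mean by (simp add: \<phi>_def)
  have "\<phi> t * Q t = c * \<bar>Q t\<bar> powr s" for t
  proof (cases "Q t = 0")
    case False
    have "\<phi> t * Q t = c * (\<bar>Q t\<bar> powr 1 * \<bar>Q t\<bar> powr (s - 1))"
      using False by (simp add: \<phi>_def sgn_real_def)
    then show ?thesis by (simp only: powr_add[symmetric]) simp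
  qed (simp add: \<phi>_def)
  then have "(LINT t:{-pi..pi}|lebesgue. \<phi> t * Q t) = c * I" by (simp add: I_def)
  also have "\<dots> = I powr (1 / s)"
    using powr_add[of I "1 / s - 1" 1] I by (simp add: c_def)
  finally have val: "(LINT t:{-pi..pi}|lebesgue. \<phi> t * Q t) = I powr (1 / s)" .
  from p have "\<phi> \<in> Lp_ball0 p"
  proof (cases rule: conjugate_exponent_cases)
    case 1
    have "c = 1" using I 1 by (simp add: c_def)
    then have "\<bar>\<phi> t\<bar> \<le> 1" for t using 1 abs\<phi>[of t] by simp
    then have "esssup lebesgue (\<lambda>t. ereal \<bar>\<phi> t\<bar>) \<le> ereal 1"
      using meas by (intro esssup_I) auto
    moreover from this have "real_of_ereal (esssup lebesgue (\<lambda>t. ereal \<bar>\<phi> t\<bar>)) \<le> 1"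
      by (cases "esssup lebesgue (\<lambda>t. ereal \<bar>\<phi> t\<bar>)") auto
    moreover have "esssup lebesgue (\<lambda>t. ereal \<bar>\<phi> t\<bar>) < \<infinity>"
      using calculation(1) by (rule order_le_less_trans) simp
    ultimately show ?thesis
      using 1 meas per zero by (simp add: Lp_ball0_def Lp_space_def Lp_norm_def)
  next
    case (2 p0)
    have ps: "(s - 1) * p0 = s" "p0 * (1 / s - 1) = - 1"
      using 2 by (simp_all add: field_simps)
    have eq: "\<bar>\<phi> t\<bar> powr p0 = 1 / I * \<bar>Q t\<bar> powr s" for t
    proof (cases "Q t = 0")
      case False
      have "\<bar>\<phi> t\<bar> powr p0 = c powr p0 * (\<bar>Q t\<bar> powr (s - 1)) powr p0"
        using False c by (simp add: abs\<phi> powr_mult)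
      also have "c powr p0 = I powr (- 1)"
        using ps(2) by (simp add: c_def powr_powr mult.commute)
      also have "(\<bar>Q t\<bar> powr (s - 1)) powr p0 = \<bar>Q t\<bar> powr s"
        using ps(1) by (simp add: powr_powr)
      finally show ?thesis using I by (simp add: powr_minus_divide)
    qed (simp add: abs\<phi>)
    have "set_integrable lebesgue {-pi..pi} (\<lambda>t. \<bar>\<phi> t\<bar> powr p0)"
      unfolding eq using set_integrable_powr_bounded[OF Q(1,2), of s] s by auto
    moreover have "(LINT t:{-pi..pi}|lebesgue. \<bar>\<phi> t\<bar> powr p0) = 1"
      unfolding eq using I by (simp add: I_def)
    ultimately show ?thesis
      using 2 meas per zero by (simp add: Lp_ball0_def Lp_space_def Lp_norm_def)
  qed
  then show ?thesis using val by blast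
qed

section \<open>From bounds on the pairing to the error of the class\<close>

lemma fourier_error_upper:
  assumes r: "r > 1" and n: "n \<ge> 1" and p: "1 \<le> p"
    and U: "\<And>\<phi> x. \<phi> \<in> Lp_ball0 p \<Longrightarrow>
      \<bar>LINT t:{-pi..pi}|lebesgue. \<phi> t * kernel_tail n r (\<beta> * pi / 2) (x - t)\<bar> \<le> U"
  shows "fourier_error_C n (weyl_nagy_class r \<beta> p) \<le> ereal (U / pi)"
  unfolding fourier_error_C_def C_norm_def
proof (intro SUP_least)
  fix f x assume "f \<in> weyl_nagy_class r \<beta> p"
  then obtain a \<phi> where \<phi>: "\<phi> \<in> Lp_ball0 p" and f: "\<And>x. f x = a / 2 + 1 / pi *
      (LINT t:{-pi..pi}|lebesgue. \<phi> (x - t) * weyl_nagy_kernel r \<beta> t)"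
    unfolding weyl_nagy_class_def by blast
  have "f x - fourier_sum (n - 1) f x =
    1 / pi * (LINT t:{-pi..pi}|lebesgue. \<phi> t * kernel_tail n r (\<beta> * pi / 2) (x - t))"
    by (rule weyl_nagy_remainder[OF r n _ Lp_ball0_L1(1)[OF \<phi> p] f])
       (use \<phi> in \<open>auto simp: Lp_ball0_def Lp_space_def\<close>)
  then have "\<bar>f x - fourier_sum (n - 1) f x\<bar> \<le> U / pi"
    using U[OF \<phi>, of x] by (simp add: abs_mult divide_right_mono)
  then show "ereal \<bar>f x - fourier_sum (n - 1) f x\<bar> \<le> ereal (U / pi)" by simp
qed

text \<open>A single function of the class, with a_0 = 0 and evaluated at 0, already bounds the
  supremum from below.\<close>

lemma fourier_error_lower:
  assumes r: "r > 1" and n: "n \<ge> 1" and p: "1 \<le> p" and \<phi>: "\<phi> \<in> Lp_ball0 p"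
    and L: "L \<le> (LINT t:{-pi..pi}|lebesgue. \<phi> t * kernel_tail n r (\<beta> * pi / 2) (0 - t))"
  shows "ereal (L / pi) \<le> fourier_error_C n (weyl_nagy_class r \<beta> p)"
proof -
  define f where "f x = 0 / 2 + 1 / pi *
      (LINT t:{-pi..pi}|lebesgue. \<phi> (x - t) * weyl_nagy_kernel r \<beta> t)" for x
  have "f \<in> weyl_nagy_class r \<beta> p"
    unfolding weyl_nagy_class_def using \<phi> f_def by blast
  moreover have "f 0 - fourier_sum (n - 1) f 0 =
    1 / pi * (LINT t:{-pi..pi}|lebesgue. \<phi> t * kernel_tail n r (\<beta> * pi / 2) (0 - t))"
    by (rule weyl_nagy_remainder[OF r n _ Lp_ball0_L1(1)[OF \<phi> p] f_def])
       (use \<phi> in \<open>auto simp: Lp_ball0_def Lp_space_def\<close>)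
  then have "L / pi \<le> f 0 - fourier_sum (n - 1) f 0"
    using L by (simp add: divide_right_mono)
  then have "ereal (L / pi) \<le> ereal \<bar>f 0 - fourier_sum (n - 1) f 0\<bar>" by simp
  ultimately show ?thesis
    unfolding fourier_error_C_def C_norm_def
    by (intro SUP_upper2[of f] SUP_upper2[of 0]) auto
qed

lemma kernel_tail_borel: "kernel_tail n r b \<in> borel_measurable borel"
  unfolding kernel_tail_def[abs_def] by measurable

text \<open>Common frame of both cases: \<open>P\<close> replaces the scaled tail and
  \<open>X\<close> is its dual norm. Replacing the kernel costs \<open>\<eta>\<close> times the L_1
  bound 2 pi + 1 in each direction, and \<open>\<delta>\<close> is the slack left when
  \<open>X\<close> is only approached.\<close>

lemma fourier_error_sandwich:
  fixes n :: nat and r :: real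
  assumes n: "n \<ge> 1" and r: "r > 1" and p: "1 \<le> p"
    and P: "P \<in> borel_measurable borel" "\<And>t. \<bar>P t\<bar> \<le> M"
    and approx: "\<And>t. \<bar>real n powr r * kernel_tail n r (\<beta> * pi / 2) t - P t\<bar> \<le> \<eta>"
    and up: "\<And>\<phi> x. \<phi> \<in> Lp_ball0 p \<Longrightarrow> \<bar>LINT t:{-pi..pi}|lebesgue. \<phi> t * P (x - t)\<bar> \<le> X"
    and low: "\<phi>0 \<in> Lp_ball0 p" "X - \<delta> \<le> (LINT t:{-pi..pi}|lebesgue. \<phi>0 t * P (0 - t))" "\<delta> \<ge> 0"
  shows "\<exists>v. fourier_error_C n (weyl_nagy_class r \<beta> p) = ereal (real n powr (- r) * v) \<and>
    \<bar>v - X / pi\<bar> \<le> ((2 * pi + 1) * \<eta> + \<delta>) / pi"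
proof -
  let ?T = "kernel_tail n r (\<beta> * pi / 2)"
  define E where "E = fourier_error_C n (weyl_nagy_class r \<beta> p)"
  define w where "w = real n powr (- r)"
  have w: "w > 0" using n by (simp add: w_def)
  have wn: "w * real n powr r = 1" using n by (simp add: w_def powr_minus)
  have \<eta>: "\<eta> \<ge> 0" using approx[of 0] by linarith
  define R where "R t = real n powr r * ?T t - P t" for t
  have T: "?T t = w * (P t + R t)" for t
    using wn by (simp add: R_def mult.assoc[symmetric])
  have meas: "(\<lambda>t. P (x - t)) \<in> borel_measurable lebesgue" "(\<lambda>t. R (x - t)) \<in> borel_measurable lebesgue" for x
  proof -
    have "(\<lambda>t. P (x - t)) \<in> borel_measurable borel" "(\<lambda>t. R (x - t)) \<in> borel_measurable borel"
      unfolding R_def using P(1) kernel_tail_borel[of n r "\<beta> * pi / 2"] by measurable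
    then show "(\<lambda>t. P (x - t)) \<in> borel_measurable lebesgue" "(\<lambda>t. R (x - t)) \<in> borel_measurable lebesgue"
      by (simp_all add: measurable_completion)
  qed
  have split: "\<bar>(LINT t:{-pi..pi}|lebesgue. \<phi> t * ?T (x - t)) - w * (LINT t:{-pi..pi}|lebesgue. \<phi> t * P (x - t))\<bar>
      \<le> w * ((2 * pi + 1) * \<eta>)" if \<phi>: "\<phi> \<in> Lp_ball0 p" for \<phi> x
  proof -
    note I = Lp_ball0_L1[OF \<phi> p]
    note IP = set_integrable_mult_bounded(1)[OF I(1) meas(1)[of x] P(2)]
    note IR = set_integrable_mult_bounded[OF I(1) meas(2)[of x], of \<eta>]
    have IR': "set_integrable lebesgue {-pi..pi} (\<lambda>t. \<phi> t * R (x - t))"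
      "\<bar>LINT t:{-pi..pi}|lebesgue. \<phi> t * R (x - t)\<bar> \<le> \<eta> * (LINT t:{-pi..pi}|lebesgue. \<bar>\<phi> t\<bar>)"
      using IR approx by (auto simp: R_def)
    have "(LINT t:{-pi..pi}|lebesgue. \<phi> t * ?T (x - t))
        = (LINT t:{-pi..pi}|lebesgue. w * (\<phi> t * P (x - t) + \<phi> t * R (x - t)))"
      unfolding T by (simp add: algebra_simps)
    also have "\<dots> = w * ((LINT t:{-pi..pi}|lebesgue. \<phi> t * P (x - t)) + (LINT t:{-pi..pi}|lebesgue. \<phi> t * R (x - t)))"
      by (simp add: set_integral_add(2)[OF IP IR'(1)])
    finally have "\<bar>(LINT t:{-pi..pi}|lebesgue. \<phi> t * ?T (x - t)) - w * (LINT t:{-pi..pi}|lebesgue. \<phi> t * P (x - t))\<bar>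
        = w * \<bar>LINT t:{-pi..pi}|lebesgue. \<phi> t * R (x - t)\<bar>"
      using w by (simp add: distrib_left abs_mult)
    also have "\<dots> \<le> w * (\<eta> * (2 * pi + 1))"
      using IR'(2) I(2) \<eta> w by (intro mult_left_mono order_trans[OF IR'(2)]) auto
    finally show ?thesis by (simp add: mult.commute)
  qed
  have "E \<le> ereal (w * (X + (2 * pi + 1) * \<eta>) / pi)"
    unfolding E_def
  proof (rule fourier_error_upper[OF r n p])
    fix \<phi> x assume \<phi>: "\<phi> \<in> Lp_ball0 p"
    have "\<bar>w * (LINT t:{-pi..pi}|lebesgue. \<phi> t * P (x - t))\<bar> \<le> w * X"
      using up[OF \<phi>, of x] w by (simp add: abs_mult)
    then show "\<bar>LINT t:{-pi..pi}|lebesgue. \<phi> t * ?T (x - t)\<bar> \<le> w * (X + (2 * pi + 1) * \<eta>)"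
      using split[OF \<phi>, of x] unfolding distrib_left[of w X] by linarith
  qed
  moreover have "ereal (w * (X - \<delta> - (2 * pi + 1) * \<eta>) / pi) \<le> E"
    unfolding E_def
  proof (rule fourier_error_lower[OF r n p low(1)])
    have "w * (X - \<delta>) \<le> w * (LINT t:{-pi..pi}|lebesgue. \<phi>0 t * P (0 - t))"
      using low(2) w by (intro mult_left_mono) auto
    then show "w * (X - \<delta> - (2 * pi + 1) * \<eta>) \<le> (LINT t:{-pi..pi}|lebesgue. \<phi>0 t * ?T (0 - t))"
      using split[OF low(1), of 0] unfolding right_diff_distrib[of w "X - \<delta>"] by linarith
  qed
  \<comment> \<open>Real bounds on both sides exclude infinite values of the supremum.\<close>
  ultimately obtain e where e: "E = ereal e" "e \<le> w * (X + (2 * pi + 1) * \<eta>) / pi"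
    "w * (X - \<delta> - (2 * pi + 1) * \<eta>) / pi \<le> e"
    by (cases E) auto
  define v where "v = e / w"
  have "v \<le> X / pi + (2 * pi + 1) * \<eta> / pi"
    using e(2) w unfolding v_def by (simp add: pos_divide_le_eq mult.commute add_divide_distrib distrib_left)
  moreover have "X / pi - \<delta> / pi - (2 * pi + 1) * \<eta> / pi \<le> v"
    using e(3) w unfolding v_def by (simp add: pos_le_divide_eq mult.commute diff_divide_distrib right_diff_distrib)
  moreover have "\<delta> / pi \<ge> 0" using low(3) by simp
  ultimately have "\<bar>v - X / pi\<bar> \<le> ((2 * pi + 1) * \<eta> + \<delta>) / pi"
    unfolding add_divide_distrib by linarith
  moreover have "E = ereal (w * v)" using e(1) w by (simp add: v_def)
  ultimately show ?thesis unfolding E_def w_def by blast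
qed

section \<open>The step kernel\<close>

lemma geom_periodic: "geom q (t + 2 * pi) = geom q t"
  by (simp add: geom_def flip: cis_mult)

text \<open>The form that \<open>step_integral\<close> consumes: amplitude and phase depend on
  \<open>t\<close> only through the grid point.\<close>

lemma step_kernel_polar:
  "step_kernel n q b t = norm (geom q (grid n t)) * cos (real n * t + (Arg (geom q (grid n t)) - b))"
proof -
  let ?z = "geom q (grid n t)"
  have "cis (real n * t - b) * ?z = cis (real n * t - b) * rcis (norm ?z) (Arg ?z)"
    by (simp only: rcis_cmod_Arg)
  also have "\<dots> = rcis (norm ?z) (real n * t + (Arg ?z - b))"
    by (simp add: rcis_def cis_mult algebra_simps)
  finally show ?thesis by (simp add: step_kernel_def)
qed

lemma step_kernel_periodic:
  assumes "n \<ge> 1"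
  shows "step_kernel n q b (t + 2 * pi) = step_kernel n q b t"
proof -
  have "cis (real n * (t + 2 * pi) - b) = cis ((real n * t - b) + 2 * pi * of_int (int n))"
    by (simp add: algebra_simps)
  also have "\<dots> = cis (real n * t - b)"
    by (rule periodic_of_int) (simp flip: cis_mult)
  finally show ?thesis
    by (simp only: step_kernel_def grid_periodic[OF assms] geom_periodic)
qed

lemma borel_measurable_geom: "0 \<le> q \<Longrightarrow> q < 1 \<Longrightarrow> geom q \<in> borel_measurable borel"
proof (rule borel_measurable_continuous_onI)
  assume q: "0 \<le> q" "q < 1"
  have "1 - of_real q * cis t \<noteq> 0" for t
    using one_minus_cis_bounds(1)[of q t] q by auto
  then show "continuous_on UNIV (geom q)"
    unfolding geom_def[abs_def] by (intro continuous_intros) auto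
qed

lemma borel_measurable_step_kernel:
  assumes "0 \<le> q" "q < 1"
  shows "step_kernel n q b \<in> borel_measurable borel"
proof -
  have [measurable]: "geom q \<in> borel_measurable borel" by (rule borel_measurable_geom[OF assms])
  have [measurable]: "cis \<in> borel_measurable borel"
    by (intro borel_measurable_continuous_onI continuous_intros)
  have "(\<lambda>t. cis (real n * t - b) * geom q (grid n t)) \<in> borel_measurable borel" by measurable
  then show ?thesis
    unfolding step_kernel_def[abs_def] by (rule borel_measurable_Re[THEN measurable_compose_rev]) 
qed

lemma step_kernel_bound:
  assumes "0 \<le> q" "q < 1"
  shows "\<bar>step_kernel n q b t\<bar> \<le> 1 / (1 - q)"
proof -
  have "\<bar>step_kernel n q b t\<bar> \<le> norm (cis (real n * t - b) * geom q (grid n t))"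
    unfolding step_kernel_def by (rule abs_Re_le_cmod)
  also have "\<dots> \<le> 1 / (1 - q)" using geom_norm_bounds(1)[OF assms] by (simp add: norm_mult)
  finally show ?thesis .
qed

section \<open>Moments of the step kernel and their comparison with the hypergeometric value\<close>

definition grid_mean :: "nat \<Rightarrow> real \<Rightarrow> real \<Rightarrow> real" where
  "grid_mean n q s = (\<Sum>k<n. norm (geom q (2 * pi * real k / n)) powr s) / n"

definition cos_moment :: "real \<Rightarrow> real" where
  "cos_moment s = (LINT t:{-pi..pi}|lebesgue. \<bar>cos t\<bar> powr s)"

lemma cos_powr_integrable:
  assumes "s \<ge> 0"
  shows "set_integrable lebesgue {-pi..pi} (\<lambda>t. \<bar>cos t\<bar> powr s)"
    and "set_integrable lebesgue {-pi..pi} (\<lambda>t. sgn (cos t) * \<bar>cos t\<bar> powr s)"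
proof -
  have c: "(\<lambda>t. cos t) \<in> borel_measurable (lebesgue :: real measure)"
    by (simp add: measurable_completion borel_measurable_continuous_onI continuous_intros)
  show I: "set_integrable lebesgue {-pi..pi} (\<lambda>t. \<bar>cos t\<bar> powr s)"
    by (rule set_integrable_powr_bounded[OF c abs_cos_le_one assms])
  have "set_integrable lebesgue {-pi..pi} (\<lambda>t. \<bar>cos t\<bar> powr s * sgn (cos t))"
    by (rule set_integrable_mult_bounded(1)[OF I, where M = 1])
       (use c in \<open>auto intro: borel_measurable_sgn simp: abs_sgn_eq\<close>)
  then show "set_integrable lebesgue {-pi..pi} (\<lambda>t. sgn (cos t) * \<bar>cos t\<bar> powr s)"
    by (simp add: mult.commute)
qed

text \<open>The bound 2 pi is uniform in \<open>s\<close>, so multiplying an error by the norm of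
  the cosine keeps the constant absolute.\<close>

lemma cos_moment_bounds:
  assumes "s \<ge> 1"
  shows "cos_moment s > 0" "cos_moment s powr (1 / s) \<le> 2 * pi"
proof -
  have s: "s \<ge> 0" using assms by simp
  note I = cos_powr_integrable(1)[OF s]
  show pos: "cos_moment s > 0"
    unfolding cos_moment_def
  proof (rule set_integral_pos[OF I, where u = 0 and v = "pi / 3" and c = "(1 / 2) powr s"])
    fix t assume t: "t \<in> {0..pi / 3}"
    then have "cos (pi / 3) \<le> cos t" by (intro cos_monotone_0_pi_le) auto
    then have "1 / 2 \<le> \<bar>cos t\<bar>" by (simp add: cos_60)
    then show "(1 / 2) powr s \<le> \<bar>cos t\<bar> powr s" using s by (intro powr_mono2) auto
  qed auto
  have "cos_moment s \<le> (LINT t:{-pi..pi}|lebesgue. 1)"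
    unfolding cos_moment_def
    by (rule set_integral_mono[OF I set_integrable_const_period]) (use s in \<open>auto intro!: powr_le1\<close>)
  then have "cos_moment s \<le> 2 * pi" by (simp only: set_integral_one_period)
  then have "cos_moment s powr (1 / s) \<le> (2 * pi) powr (1 / s)"
    using pos assms by (intro powr_mono2) auto
  also have "\<dots> \<le> (2 * pi) powr 1"
    using pi_gt3 assms by (intro powr_mono) auto
  finally show "cos_moment s powr (1 / s) \<le> 2 * pi" by simp
qed

text \<open>The shift \<open>b\<close> sits only in the phase, which \<open>step_integral\<close>
  removes; this is why the main term does not depend on \<open>\<beta>\<close>.\<close>

lemma step_kernel_integrals:
  assumes n: "n \<ge> 1" and s: "s \<ge> 1"
  shows "(LINT t:{-pi..pi}|lebesgue. \<bar>step_kernel n q b t\<bar> powr s) = grid_mean n q s * cos_moment s"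
    and "(LINT t:{-pi..pi}|lebesgue. sgn (step_kernel n q b t) * \<bar>step_kernel n q b t\<bar> powr (s - 1)) = 0"
    and "(LINT t:{-pi..pi}|lebesgue. norm (geom q (grid n t)) powr s) = 2 * pi * grid_mean n q s"
proof -
  let ?g = "\<lambda>x. Arg (geom q x) - b"
  have per: "norm (geom q (x + 2 * pi)) powr u = norm (geom q x) powr u" "?g (x + 2 * pi) = ?g x" for x u
    by (simp_all only: geom_periodic)
  show "(LINT t:{-pi..pi}|lebesgue. \<bar>step_kernel n q b t\<bar> powr s) = grid_mean n q s * cos_moment s"
    unfolding grid_mean_def cos_moment_def step_kernel_polar abs_mult abs_norm_cancel
    by (subst powr_mult)
       (rule step_integral(2)[where h = "\<lambda>x. \<bar>x\<bar> powr s" and a = "\<lambda>x. norm (geom q x) powr s" and g = ?g,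
          OF n cos_powr_integrable(1) per], use s in simp)
  have h: "set_integrable lebesgue {-pi..pi} (\<lambda>t. sgn (cos t) * \<bar>cos t\<bar> powr (s - 1))"
    by (rule cos_powr_integrable(2)) (use s in simp)
  have z: "(LINT t:{-pi..pi}|lebesgue. sgn (cos t) * \<bar>cos t\<bar> powr (s - 1)) = 0"
    by (rule cos_odd_integral_zero[where h = "\<lambda>x. sgn x * \<bar>x\<bar> powr (s - 1)", OF _ h]) (simp add: sgn_minus)
  have e: "sgn (step_kernel n q b t) * \<bar>step_kernel n q b t\<bar> powr (s - 1)
      = sgn (norm (geom q (grid n t))) * norm (geom q (grid n t)) powr (s - 1) *
        (sgn (cos (real n * t + ?g (grid n t))) * \<bar>cos (real n * t + ?g (grid n t))\<bar> powr (s - 1))" for t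
    unfolding step_kernel_polar abs_mult abs_norm_cancel sgn_mult by (simp add: powr_mult)
  show "(LINT t:{-pi..pi}|lebesgue. sgn (step_kernel n q b t) * \<bar>step_kernel n q b t\<bar> powr (s - 1)) = 0"
    unfolding e
    by (subst step_integral(2)[where h = "\<lambda>x. sgn x * \<bar>x\<bar> powr (s - 1)" and g = ?g
          and a = "\<lambda>x. sgn (norm (geom q x)) * norm (geom q x) powr (s - 1)", OF n h])
       (simp_all only: geom_periodic z mult_zero_right)
  show "(LINT t:{-pi..pi}|lebesgue. norm (geom q (grid n t)) powr s) = 2 * pi * grid_mean n q s"
    using step_integral(2)[where h = "\<lambda>x. 1" and a = "\<lambda>x. norm (geom q x) powr s" and g = ?g,
          OF n set_integrable_const_period per]
    by (simp add: set_integral_one_period grid_mean_def)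
qed

lemma powr_integral_le:
  fixes f g :: "real \<Rightarrow> real"
  assumes f: "f \<in> borel_measurable borel" "\<And>t. 0 \<le> f t" and fg: "\<And>t. f t \<le> \<kappa> * g t"
    and g: "g \<in> borel_measurable borel" "\<And>t. 0 \<le> g t" "\<And>t. g t \<le> M"
    and s: "s \<ge> 0" "\<kappa> \<ge> 0"
  shows "(LINT t:{-pi..pi}|lebesgue. f t powr s) \<le> \<kappa> powr s * (LINT t:{-pi..pi}|lebesgue. g t powr s)"
proof -
  have fM: "f t \<le> \<kappa> * M" for t
    using fg[of t] mult_left_mono[OF g(3)[of t] s(2)] by linarith
  have m: "f \<in> borel_measurable lebesgue" "g \<in> borel_measurable lebesgue"
    using f g by (auto simp: measurable_completion)
  have If: "set_integrable lebesgue {-pi..pi} (\<lambda>t. f t powr s)"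
    using set_integrable_powr_bounded[OF m(1), of "\<kappa> * M" s] f fM s by simp
  have Ig: "set_integrable lebesgue {-pi..pi} (\<lambda>t. g t powr s)"
    using set_integrable_powr_bounded[OF m(2), of M s] g s by simp
  have "(LINT t:{-pi..pi}|lebesgue. f t powr s) \<le> (LINT t:{-pi..pi}|lebesgue. \<kappa> powr s * g t powr s)"
  proof (rule set_integral_mono[OF If])
    show "set_integrable lebesgue {-pi..pi} (\<lambda>t. \<kappa> powr s * g t powr s)" using Ig by simp
    show "f t powr s \<le> \<kappa> powr s * g t powr s" for t
      using powr_mono2[OF s(1) f(2) fg, of t] by (simp add: powr_mult)
  qed
  then show ?thesis by simp
qed

lemma grid_mean_approx:
  assumes n: "n \<ge> 1" and q: "0 \<le> q" "q \<le> 1 / 2" and s: "s \<ge> 1"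
  shows "\<bar>grid_mean n q s powr (1 / s) - hypergeom (s / 2) (s / 2) 1 (q\<^sup>2) powr (1 / s)\<bar> \<le> 32 * pi * q / n"
    and "grid_mean n q s > 0"
proof -
  define A where "A = grid_mean n q s"
  define H where "H = hypergeom (s / 2) (s / 2) 1 (q\<^sup>2)"
  define f where "f t = norm (geom q (grid n t))" for t
  define g where "g t = norm (geom q t)" for t
  \<comment> \<open>Lipschitz constant 4 q times the cell length 2 pi/n.\<close>
  define \<delta> where "\<delta> = 8 * pi * q / n"
  have q1: "q < 1" using q by simp
  have \<delta>: "\<delta> \<ge> 0" using q by (simp add: \<delta>_def)
  have gm[measurable]: "geom q \<in> borel_measurable borel" by (rule borel_measurable_geom[OF q(1) q1])
  have fm: "f \<in> borel_measurable borel" and gm': "g \<in> borel_measurable borel"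
    unfolding f_def[abs_def] g_def[abs_def] by measurable
  have b: "1 / 2 \<le> norm (geom q t)" "norm (geom q t) \<le> 2" for t
  proof -
    have "1 / (1 - q) \<le> 2" "1 / 2 \<le> 1 / (1 + q)" using q by (simp_all add: field_simps)
    then show "1 / 2 \<le> norm (geom q t)" "norm (geom q t) \<le> 2"
      using geom_norm_bounds[OF q(1) q1, of t] by linarith+
  qed
  have fb: "1 / 2 \<le> f t" "0 \<le> f t" "f t \<le> 2" and gb: "1 / 2 \<le> g t" "0 \<le> g t" "g t \<le> 2" for t
    using b by (auto simp: f_def g_def)
  have diff: "\<bar>f t - g t\<bar> \<le> \<delta>" for t
  proof -
    have "\<bar>f t - g t\<bar> \<le> norm (geom q (grid n t) - geom q t)"
      unfolding f_def g_def by (rule norm_triangle_ineq3)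
    also have "\<dots> \<le> 4 * q * \<bar>grid n t - t\<bar>" by (rule geom_diff_bound[OF q])
    also have "\<dots> \<le> 4 * q * (2 * pi / n)"
      using grid_bounds[OF n, of t] q by (intro mult_left_mono) auto
    finally show ?thesis by (simp add: \<delta>_def mult_ac)
  qed
  \<comment> \<open>Both moduli are at least 1/2, so the additive error \<open>\<delta>\<close> is
    at most 2 \<open>\<delta>\<close> times either of them.\<close>
  have fg: "f t \<le> (1 + 2 * \<delta>) * g t" and gf: "g t \<le> (1 + 2 * \<delta>) * f t" for t
  proof -
    have "\<delta> \<le> 2 * \<delta> * g t" "\<delta> \<le> 2 * \<delta> * f t"
      using mult_left_mono[OF gb(1)[of t], of "2 * \<delta>"] mult_left_mono[OF fb(1)[of t], of "2 * \<delta>"] \<delta> by auto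
    then show "f t \<le> (1 + 2 * \<delta>) * g t" "g t \<le> (1 + 2 * \<delta>) * f t"
      using diff[of t] by (auto simp: distrib_right)
  qed
  have s0: "s \<ge> 0" using s by simp
  have \<kappa>: "1 + 2 * \<delta> \<ge> 0" using \<delta> by simp
  have If: "(LINT t:{-pi..pi}|lebesgue. f t powr s) = 2 * pi * A"
    unfolding f_def A_def by (rule step_kernel_integrals(3)[OF n s])
  have Ig: "(LINT t:{-pi..pi}|lebesgue. g t powr s) = 2 * pi * H"
    unfolding g_def H_def by (rule geom_powr_integral[OF q(1) q1])
  show A0: "grid_mean n q s > 0"
  proof -
    have "(\<Sum>k<n. norm (geom q (2 * pi * real k / n)) powr s) > 0"
    proof (rule sum_pos)
      fix k
      have "norm (geom q (2 * pi * real k / n)) > 0" using b(1)[of "2 * pi * real k / n"] by linarith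
      then show "norm (geom q (2 * pi * real k / n)) powr s > 0" by simp
    qed (use n in \<open>auto simp: lessThan_empty_iff\<close>)
    then show ?thesis using n by (simp add: grid_mean_def)
  qed
  have "2 * pi * A \<le> (1 + 2 * \<delta>) powr s * (2 * pi * H)"
    using powr_integral_le[OF fm fb(2) fg gm' gb(2,3) s0 \<kappa>] unfolding If Ig .
  then have AH: "A \<le> (1 + 2 * \<delta>) powr s * H"
    using mult_le_cancel_left_pos[of "2 * pi" A "(1 + 2 * \<delta>) powr s * H"] pi_gt_zero by (simp add: mult_ac)
  have "2 * pi * H \<le> (1 + 2 * \<delta>) powr s * (2 * pi * A)"
    using powr_integral_le[OF gm' gb(2) gf fm fb(2,3) s0 \<kappa>] unfolding If Ig .
  then have HA: "H \<le> (1 + 2 * \<delta>) powr s * A"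
    using mult_le_cancel_left_pos[of "2 * pi" H "(1 + 2 * \<delta>) powr s * A"] pi_gt_zero by (simp add: mult_ac)
  have "2 * pi * A \<le> 2 powr s * (LINT t:{-pi..pi}|lebesgue. 1 powr s)"
    using powr_integral_le[OF fm fb(2), of 2 "\<lambda>_. 1" 1 s] fb(3) s0 unfolding If by simp
  then have A2: "A \<le> 2 powr s" by (simp add: set_integral_one_period)
  have "2 * pi * H \<le> 2 powr s * (LINT t:{-pi..pi}|lebesgue. 1 powr s)"
    using powr_integral_le[OF gm' gb(2), of 2 "\<lambda>_. 1" 1 s] gb(3) s0 unfolding Ig by simp
  then have H2: "H \<le> 2 powr s" by (simp add: set_integral_one_period)
  have H0: "H > 0"
  proof (rule ccontr)
    assume "\<not> H > 0"
    then have "(1 + 2 * \<delta>) powr s * H \<le> 0" by (intro mult_nonneg_nonpos) auto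
    then show False using AH A0 by (simp add: A_def)
  qed
  have root: "x powr (1 / s) \<le> c * y powr (1 / s)" if "x \<le> c powr s * y" "0 \<le> x" "0 \<le> y" "0 \<le> c" for x y c
  proof -
    have "x powr (1 / s) \<le> (c powr s * y) powr (1 / s)"
      using that s by (intro powr_mono2) auto
    also have "\<dots> = c * y powr (1 / s)"
      using that s by (simp add: powr_mult powr_powr)
    finally show ?thesis .
  qed
  define a where "a = A powr (1 / s)"
  define h where "h = H powr (1 / s)"
  have "a \<le> (1 + 2 * \<delta>) * h" "h \<le> (1 + 2 * \<delta>) * a"
    unfolding a_def h_def using root[OF AH _ _ \<kappa>] root[OF HA _ _ \<kappa>] A0 H0 by (auto simp: A_def)
  \<comment> \<open>With both roots at most 2, the relative error 2 \<open>\<delta>\<close> becomes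
    the absolute error 4 \<open>\<delta>\<close>, that is 32 pi q/n.\<close>
  moreover have "a \<le> 2" "h \<le> 2"
    unfolding a_def h_def using root[of A 2 1] root[of H 2 1] A2 H2 A0 H0 by (auto simp: A_def)
  then have "\<delta> * h \<le> \<delta> * 2" "\<delta> * a \<le> \<delta> * 2" using \<delta> by (auto intro!: mult_left_mono)
  ultimately have "\<bar>a - h\<bar> \<le> 4 * \<delta>" by (auto simp: distrib_right)
  then show "\<bar>grid_mean n q s powr (1 / s) - hypergeom (s / 2) (s / 2) 1 (q\<^sup>2) powr (1 / s)\<bar> \<le> 32 * pi * q / n"
    by (simp add: a_def h_def A_def H_def \<delta>_def)
qed

text \<open>The point \<open>x\<close> merely reflects and translates the kernel, which integrals
  over a period do not notice; so the same value bounds the pairing, and is attained, for every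
  \<open>x\<close>.\<close>

lemma step_kernel_extremal:
  assumes n: "n \<ge> 1" and q: "0 \<le> q" "q \<le> 1 / 2" and p: "1 < p" "1 / p + 1 / ereal s = 1"
  shows "\<And>\<phi>. \<phi> \<in> Lp_ball0 p \<Longrightarrow> \<bar>LINT t:{-pi..pi}|lebesgue. \<phi> t * step_kernel n q b (x - t)\<bar>
    \<le> (grid_mean n q s * cos_moment s) powr (1 / s)"
    and "\<exists>\<phi>\<in>Lp_ball0 p. (LINT t:{-pi..pi}|lebesgue. \<phi> t * step_kernel n q b (x - t))
      = (grid_mean n q s * cos_moment s) powr (1 / s)"
proof -
  let ?P = "step_kernel n q b"
  have q1: "q < 1" using q by simp
  have s: "s \<ge> 1" using p by (rule conjugate_exponent_cases) auto
  have m: "?P \<in> borel_measurable borel" by (rule borel_measurable_step_kernel[OF q(1) q1])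
  have m': "?P \<in> borel_measurable lebesgue" using m by (simp add: measurable_completion)
  have "(\<lambda>t. ?P (x - t)) \<in> borel_measurable borel" using m by measurable
  then have Q: "(\<lambda>t. ?P (x - t)) \<in> borel_measurable lebesgue" by (simp add: measurable_completion)
  note bd = step_kernel_bound[OF q(1) q1, of n b]
  note per = step_kernel_periodic[OF n, of q b]
  have perQ: "?P (x - (t + 2 * pi)) = ?P (x - t)" for t
    using per[of "x - t - 2 * pi"] by (simp add: algebra_simps)
  have I: "(LINT t:{-pi..pi}|lebesgue. \<bar>?P (x - t)\<bar> powr s) = grid_mean n q s * cos_moment s"
    using periodic_reflect(2)[of "\<lambda>t. \<bar>?P t\<bar> powr s" x] set_integrable_powr_bounded[OF m' bd, of s] per s
      step_kernel_integrals(1)[OF n s, of q b] by simp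
  have pos: "grid_mean n q s * cos_moment s > 0"
    using grid_mean_approx(2)[OF n q s] cos_moment_bounds(1)[OF s] by simp
  show "\<bar>LINT t:{-pi..pi}|lebesgue. \<phi> t * ?P (x - t)\<bar> \<le> (grid_mean n q s * cos_moment s) powr (1 / s)"
    if "\<phi> \<in> Lp_ball0 p" for \<phi>
    using Lp_ball0_pairing_le[OF that p Q bd] pos unfolding I by blast
  have sI: "set_integrable lebesgue {-pi..pi} (\<lambda>t. sgn (?P t) * \<bar>?P t\<bar> powr (s - 1))"
  proof -
    have "set_integrable lebesgue {-pi..pi} (\<lambda>t. \<bar>?P t\<bar> powr (s - 1) * sgn (?P t))"
      by (rule set_integrable_mult_bounded(1)[where M = 1])
         (use set_integrable_powr_bounded[OF m' bd, of "s - 1"] s m' in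
           \<open>auto intro: borel_measurable_sgn simp: abs_sgn_eq\<close>)
    then show ?thesis by (simp add: mult.commute)
  qed
  have mean: "(LINT t:{-pi..pi}|lebesgue. sgn (?P (x - t)) * \<bar>?P (x - t)\<bar> powr (s - 1)) = 0"
    using periodic_reflect(2)[OF _ sI, of x] per step_kernel_integrals(2)[OF n s, of q b] by simp
  show "\<exists>\<phi>\<in>Lp_ball0 p. (LINT t:{-pi..pi}|lebesgue. \<phi> t * ?P (x - t))
      = (grid_mean n q s * cos_moment s) powr (1 / s)"
    using Lp_ball0_extremal[OF p Q bd perQ mean] pos unfolding I by blast
qed

section \<open>The error estimates\<close>

text \<open>Here the dual norm is the supremum of the kernel. On a full cell the kernel has positive
  and negative peaks of equal height, so mass can be placed on both with opposite signs, and the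
  mean-zero constraint costs nothing.\<close>

lemma step_kernel_extremal_L1:
  assumes n: "n \<ge> 1" and q: "0 \<le> q" "q < 1"
  shows "\<And>\<phi>. \<phi> \<in> Lp_ball0 1 \<Longrightarrow>
      \<bar>LINT t:{-pi..pi}|lebesgue. \<phi> t * step_kernel n q b (x - t)\<bar> \<le> 1 / (1 - q)"
    and "\<And>\<epsilon>. 0 < \<epsilon> \<Longrightarrow> \<epsilon> < 1 \<Longrightarrow> \<exists>\<phi>\<in>Lp_ball0 1.
      (1 - \<epsilon>) / (1 - q) \<le> (LINT t:{-pi..pi}|lebesgue. \<phi> t * step_kernel n q b (x - t))"
proof -
  let ?P = "step_kernel n q b"
  note bd = step_kernel_bound[OF q, of n b]
  note per = step_kernel_periodic[OF n, of q b]
  have m: "?P \<in> borel_measurable borel" by (rule borel_measurable_step_kernel[OF q])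
  have m': "?P \<in> borel_measurable lebesgue" using m by (simp add: measurable_completion)
  have w0: "1 / (1 - q) > 0" using q by simp
  show "\<bar>LINT t:{-pi..pi}|lebesgue. \<phi> t * ?P (x - t)\<bar> \<le> 1 / (1 - q)" if \<phi>: "\<phi> \<in> Lp_ball0 1" for \<phi>
  proof -
    have "(\<lambda>t. ?P (x - t)) \<in> borel_measurable borel" using m by measurable
    then have Q: "(\<lambda>t. ?P (x - t)) \<in> borel_measurable lebesgue" by (simp add: measurable_completion)
    have L: "(LINT t:{-pi..pi}|lebesgue. \<bar>\<phi> t\<bar>) \<le> 1"
      using Lp_ball0_finite(2)[of \<phi> 1] \<phi> by (simp add: one_ereal_def)
    have "\<bar>LINT t:{-pi..pi}|lebesgue. \<phi> t * ?P (x - t)\<bar> \<le> 1 / (1 - q) * (LINT t:{-pi..pi}|lebesgue. \<bar>\<phi> t\<bar>)"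
      by (rule set_integrable_mult_bounded(2)[OF Lp_ball0_L1(1)[OF \<phi>] Q bd]) simp
    also have "\<dots> \<le> 1 / (1 - q) * 1" using L w0 by (intro mult_left_mono) auto
    finally show ?thesis by simp
  qed
  fix \<epsilon> :: real assume \<epsilon>: "0 < \<epsilon>" "\<epsilon> < 1"
  \<comment> \<open>The extremal function is an odd function \<open>h\<close> of the cosine, concentrated near its extrema,
    on the single cell at the origin, where the amplitude \<open>1 / (1 - q)\<close> is largest.\<close>
  define h :: "real \<Rightarrow> real" where "h y = (if y \<ge> 1 - \<epsilon> then 1 else if y \<le> - (1 - \<epsilon>) then - 1 else 0)" for y
  have h_odd: "h (- y) = - h y" for y using \<epsilon> by (auto simp: h_def)
  have h_abs: "\<bar>h y\<bar> \<le> 1" for y by (simp add: h_def)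
  have hm[measurable]: "h \<in> borel_measurable borel" unfolding h_def[abs_def] by measurable
  \<comment> \<open>Wherever \<open>h y\<close> is nonzero it has the sign of \<open>y\<close>, and
    \<bar>y\<bar> \<ge> 1 - \<open>\<epsilon>\<close>.\<close>
  have h_le: "(1 - \<epsilon>) * \<bar>h y\<bar> \<le> h y * y" for y using \<epsilon> by (auto simp: h_def)
  have hcm: "(\<lambda>t. h (cos t)) \<in> borel_measurable lebesgue"
  proof -
    have "(\<lambda>t. h (cos t)) \<in> borel_measurable borel" by measurable
    then show ?thesis by (simp add: measurable_completion)
  qed
  have hI: "set_integrable lebesgue {-pi..pi} (\<lambda>t. h (cos t))"
    by (rule set_integrable_bounded_interval[OF hcm h_abs])
  note haI = set_integrable_abs[OF hI]
  define J where "J = (LINT t:{-pi..pi}|lebesgue. \<bar>h (cos t)\<bar>)"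
  have J: "J > 0"
    unfolding J_def
  proof (rule set_integral_pos[OF haI, where u = 0 and v = "arccos (1 - \<epsilon>)" and c = 1])
    show "0 < arccos (1 - \<epsilon>)" using arccos_less_arccos[of "1 - \<epsilon>" 1] \<epsilon> by simp
    show "arccos (1 - \<epsilon>) \<le> pi" using \<epsilon> by (intro arccos_ubound) auto
    fix t assume t: "t \<in> {0..arccos (1 - \<epsilon>)}"
    have "cos (arccos (1 - \<epsilon>)) \<le> cos t"
      using t \<epsilon> arccos_ubound[of "1 - \<epsilon>"] by (intro cos_monotone_0_pi_le) auto
    then show "1 \<le> \<bar>h (cos t)\<bar>" using \<epsilon> by (simp add: h_def)
  qed auto
  \<comment> \<open>Selects the grid points that are multiples of 2 pi, hence one cell per period;
    testing the cosine makes \<open>a\<close> periodic, as \<open>step_integral\<close>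
    requires.\<close>
  define a :: "real \<Rightarrow> real" where "a y = (if cos y = 1 then 1 else 0)" for y
  have am[measurable]: "a \<in> borel_measurable borel" unfolding a_def[abs_def] by measurable
  have a_per: "a (y + 2 * pi) = a y" for y by (simp add: a_def)
  have a_sum: "(\<Sum>k<n. a (2 * pi * real k / n)) = 1"
  proof -
    have "a (2 * pi * real k / n) = (if k = 0 then 1 else 0)" if k: "k < n" for k
    proof (cases "k = 0")
      case False
      have "cos (2 * pi * real k / n) \<noteq> 1"
      proof
        assume "cos (2 * pi * real k / n) = 1"
        then obtain i :: int where "2 * pi * real k / n = of_int i * 2 * pi"
          unfolding cos_one_2pi_int by blast
        then have "real k = real_of_int i * real n" using n by (simp add: field_simps)
        then have "real_of_int (int k) = real_of_int (i * int n)" by simp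
        then have "int n dvd int k" by (simp only: of_int_eq_iff dvd_triv_right)
        then have "int n \<le> int k" using False by (intro zdvd_imp_le) auto
        then show False using k by simp
      qed
      then show ?thesis using False by (simp add: a_def)
    qed (simp add: a_def)
    then have "(\<Sum>k<n. a (2 * pi * real k / n)) = (\<Sum>k<n. if k = 0 then 1 else 0)"
      by (intro sum.cong) auto
    then show ?thesis using n by simp
  qed
  define F where "F t = a (grid n t) * h (cos (real n * t + - b))" for t
  have Fm: "F \<in> borel_measurable borel" unfolding F_def[abs_def] by measurable
  have F_abs: "\<bar>F t\<bar> = a (grid n t) * \<bar>h (cos (real n * t + - b))\<bar>" for t
    by (simp add: F_def abs_mult a_def)
  have F_per: "F (t + 2 * pi) = F t" for t
  proof -
    have "cos (real n * (t + 2 * pi) + - b) = cos ((real n * t + - b) + 2 * pi * of_int (int n))"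
      by (simp add: algebra_simps)
    also have "\<dots> = cos (real n * t + - b)" by (rule periodic_of_int) simp
    finally show ?thesis by (simp only: F_def grid_periodic[OF n] a_per)
  qed
  note stepF = step_integral[where a = a and g = "\<lambda>_. - b", OF n hI a_per refl, folded F_def]
  have F0: "(LINT t:{-pi..pi}|lebesgue. F t) = 0"
    using stepF(2) cos_odd_integral_zero[of h, OF h_odd hI] by simp
  have FJ: "(LINT t:{-pi..pi}|lebesgue. \<bar>F t\<bar>) = J / n"
    unfolding F_abs
    using step_integral(2)[where h = "\<lambda>y. \<bar>h y\<bar>" and a = a and g = "\<lambda>_. - b", OF n haI a_per refl] a_sum
    by (simp add: J_def)
  \<comment> \<open>\<open>F\<close> vanishes off the selected cells. On them \<open>geom\<close> is
    the real number 1/(1 - q), so the kernel is 1/(1 - q) times the very cosine to which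
    \<open>h\<close> is applied.\<close>
  have FP: "(1 - \<epsilon>) / (1 - q) * \<bar>F t\<bar> \<le> F t * ?P t" for t
  proof (cases "cos (grid n t) = 1")
    case True
    then have "sin (grid n t) = 0" using sin_cos_squared_add[of "grid n t"] by simp
    then have "cis (grid n t) = 1" using True by (simp add: complex_eq_iff)
    then have "geom q (grid n t) = of_real (1 / (1 - q))" by (simp add: geom_def)
    then have P: "?P t = 1 / (1 - q) * cos (real n * t + - b)"
      by (simp only: step_kernel_def) simp
    have "1 / (1 - q) * ((1 - \<epsilon>) * \<bar>F t\<bar>) \<le> 1 / (1 - q) * (F t * cos (real n * t + - b))"
      using h_le w0 True by (intro mult_left_mono) (simp_all add: F_def a_def)
    then show ?thesis unfolding P by (simp add: mult_ac)
  qed (simp add: F_def a_def)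
  \<comment> \<open>Normalises the L_1 norm: one selected cell carries the mass
    \<open>J / n\<close>.\<close>
  define c where "c = real n / J"
  have c: "c > 0" using J n by (simp add: c_def)
  define \<phi> where "\<phi> t = c * F (x - t)" for t
  have \<phi>m: "\<phi> \<in> borel_measurable lebesgue"
  proof -
    have "\<phi> \<in> borel_measurable borel" unfolding \<phi>_def[abs_def] using Fm by measurable
    then show ?thesis by (simp add: measurable_completion)
  qed
  have \<phi>_per: "\<phi> (t + 2 * pi) = \<phi> t" for t
    using F_per[of "x - t - 2 * pi"] by (simp add: \<phi>_def algebra_simps)
  note absF = set_integrable_abs[OF stepF(1)]
  have rF: "(LINT t:{-pi..pi}|lebesgue. F (x - t)) = 0"
    using periodic_reflect(2)[OF F_per stepF(1), of x] F0 by simp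
  have rabs: "set_integrable lebesgue {-pi..pi} (\<lambda>t. \<bar>F (x - t)\<bar>)"
    "(LINT t:{-pi..pi}|lebesgue. \<bar>F (x - t)\<bar>) = J / n"
    using periodic_reflect[of "\<lambda>t. \<bar>F t\<bar>" x] F_per absF FJ by auto
  have abs\<phi>: "\<bar>\<phi> t\<bar> = c * \<bar>F (x - t)\<bar>" for t using c by (simp add: \<phi>_def abs_mult)
  have \<phi>0: "(LINT t:{-pi..pi}|lebesgue. \<phi> t) = 0" using rF by (simp add: \<phi>_def)
  have \<phi>1: "set_integrable lebesgue {-pi..pi} (\<lambda>t. \<bar>\<phi> t\<bar>)" "(LINT t:{-pi..pi}|lebesgue. \<bar>\<phi> t\<bar>) = 1"
    using rabs J n by (simp_all add: abs\<phi> c_def)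
  have "\<phi> \<in> Lp_ball0 (ereal 1)"
    using \<phi>m \<phi>_per \<phi>0 \<phi>1 by (simp add: Lp_ball0_def Lp_space_def Lp_norm_def)
  then have \<phi>: "\<phi> \<in> Lp_ball0 1" by (simp add: one_ereal_def)
  have FPI: "set_integrable lebesgue {-pi..pi} (\<lambda>t. F t * ?P t)"
    by (rule set_integrable_mult_bounded(1)[OF stepF(1) m' bd])
  have "(1 - \<epsilon>) / (1 - q) = c * ((1 - \<epsilon>) / (1 - q) * (LINT t:{-pi..pi}|lebesgue. \<bar>F t\<bar>))"
    using J n by (simp add: FJ c_def)
  also have "\<dots> \<le> c * (LINT t:{-pi..pi}|lebesgue. F t * ?P t)"
  proof (intro mult_left_mono)
    have "(LINT t:{-pi..pi}|lebesgue. (1 - \<epsilon>) / (1 - q) * \<bar>F t\<bar>) \<le> (LINT t:{-pi..pi}|lebesgue. F t * ?P t)"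
      by (rule set_integral_mono[OF _ FPI FP]) (rule set_integrable_mult_right[OF absF])
    then show "(1 - \<epsilon>) / (1 - q) * (LINT t:{-pi..pi}|lebesgue. \<bar>F t\<bar>) \<le> (LINT t:{-pi..pi}|lebesgue. F t * ?P t)"
      by (simp only: set_integral_mult_right)
  qed (use c in simp)
  also have "\<dots> = (LINT t:{-pi..pi}|lebesgue. \<phi> t * ?P (x - t))"
    using periodic_reflect(2)[of "\<lambda>t. F t * ?P t" x] F_per per FPI
    by (simp add: \<phi>_def mult.assoc)
  finally show "\<exists>\<phi>\<in>Lp_ball0 1.
      (1 - \<epsilon>) / (1 - q) \<le> (LINT t:{-pi..pi}|lebesgue. \<phi> t * ?P (x - t))"
    using \<phi> by blast
qed

section \<open>The absolute constants and the two asymptotic formulas\<close>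

definition approx_const :: real where
  "approx_const = 256 * exp 1 * (pi\<^sup>2 / 6) + 8 * pi"

text \<open>In \<open>approx_const\<close> the first term comes from the coefficients and 8 pi from
  freezing. Here 2 pi + 1 is the L_1 bound on the ball, the summand 1 pays for the slack at p = 1,
  and 64 pi for the Riemann sum at p > 1.\<close>

definition error_const :: real where
  "error_const = ((2 * pi + 1) * approx_const + 1) / pi + 64 * pi"

lemma remainder_form:
  fixes v :: real
  assumes "\<bar>v - M\<bar> \<le> K * B" "B = r * w * e" "r > 0" "w > 0" "e > 0"
  shows "\<exists>\<theta>. \<bar>\<theta>\<bar> \<le> K \<and> v = M + \<theta> * r * w * e"
proof -
  have B: "B > 0" using assms by simp
  define \<theta> where "\<theta> = (v - M) / B"
  have "\<bar>\<theta>\<bar> \<le> K" using assms(1) B by (simp add: \<theta>_def pos_divide_le_eq)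
  moreover have "\<theta> * r * w * e = \<theta> * B" using assms(2) by (simp add: mult.assoc)
  then have "v = M + \<theta> * r * w * e" using B by (simp add: \<theta>_def)
  ultimately show ?thesis by blast
qed

lemma fourier_error_L1:
  fixes n :: nat and r :: real
  assumes n: "n \<ge> 2" and r: "real n + 1 \<le> r" "r \<le> (real n)\<^sup>2"
  shows "\<exists>\<theta>. \<bar>\<theta>\<bar> \<le> error_const \<and> fourier_error_C n (weyl_nagy_class r \<beta> 1) =
    ereal (real n powr (- r) *
      (1 / (pi * (1 - exp (- r / real n))) + \<theta> * r * real n powr (- 2) * exp (- r / real n)))"
proof -
  define q where "q = exp (- r / real n)"
  define B where "B = r * real n powr (- 2) * q"
  have q: "0 < q" "q \<le> 1 / 2" using exp_minus_quotient_bounds[OF n r(1)] by (auto simp: q_def)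
  have q1: "0 \<le> q" "q < 1" using q by auto
  have n1: "n \<ge> 1" and r1: "r > 1" using n r by auto
  have B: "B > 0" using r1 q n by (simp add: B_def)
  \<comment> \<open>Since 1 - q \<ge> 1/2, the loss \<open>\<epsilon>\<close> / (1 - q) is at most 2
    \<open>\<epsilon>\<close> \<le> \<open>B\<close>; the minimum with 1/2 keeps
    \<open>\<epsilon>\<close> below 1.\<close>
  define \<epsilon> where "\<epsilon> = min (1 / 2) (B / 2)"
  have \<epsilon>: "0 < \<epsilon>" "\<epsilon> < 1" "\<epsilon> \<le> B / 2" using B by (auto simp: \<epsilon>_def)
  let ?P = "step_kernel n q (\<beta> * pi / 2)"
  obtain \<phi>0 where \<phi>0: "\<phi>0 \<in> Lp_ball0 1"
    "(1 - \<epsilon>) / (1 - q) \<le> (LINT t:{-pi..pi}|lebesgue. \<phi>0 t * ?P (0 - t))"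
    using step_kernel_extremal_L1(2)[OF n1 q1 \<epsilon>(1,2), of "\<beta> * pi / 2" 0] by blast
  have "\<epsilon> / (1 - q) \<le> B"
  proof -
    have "\<epsilon> / (1 - q) \<le> \<epsilon> / (1 / 2)" using q \<epsilon> by (intro divide_left_mono) auto
    then show ?thesis using \<epsilon> by simp
  qed
  then have low: "1 / (1 - q) - B \<le> (LINT t:{-pi..pi}|lebesgue. \<phi>0 t * ?P (0 - t))"
    using \<phi>0(2) by (simp add: diff_divide_distrib)
  obtain v where v: "fourier_error_C n (weyl_nagy_class r \<beta> 1) = ereal (real n powr (- r) * v)"
    "\<bar>v - 1 / (1 - q) / pi\<bar> \<le> ((2 * pi + 1) * (approx_const * B) + B) / pi"
    using fourier_error_sandwich[OF n1 r1 order_refl borel_measurable_step_kernel[OF q1] step_kernel_bound[OF q1]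
        kernel_tail_approx[OF n r, folded q_def, folded approx_const_def B_def]
        step_kernel_extremal_L1(1)[OF n1 q1] \<phi>0(1) low] B
    by auto
  have "\<bar>v - 1 / (pi * (1 - q))\<bar> \<le> error_const * B"
  proof -
    have "((2 * pi + 1) * (approx_const * B) + B) / pi \<le> error_const * B"
      using B by (simp add: error_const_def add_divide_distrib distrib_right mult.assoc)
    then show ?thesis using v(2) by (simp add: mult.commute)
  qed
  from remainder_form[OF this B_def _ _ q(1)] obtain \<theta> where
    "\<bar>\<theta>\<bar> \<le> error_const" "v = 1 / (pi * (1 - q)) + \<theta> * r * real n powr (- 2) * q"
    using r1 n by auto
  then show ?thesis using v(1) unfolding q_def by blast
qed

lemma fourier_error_Lp:
  fixes n :: nat and r :: real
  assumes n: "n \<ge> 2" and r: "real n + 1 \<le> r" "r \<le> (real n)\<^sup>2"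
    and p: "1 < p" "1 / p + 1 / ereal s = 1"
  shows "\<exists>\<theta>. \<bar>\<theta>\<bar> \<le> error_const \<and> fourier_error_C n (weyl_nagy_class r \<beta> p) =
    ereal (real n powr (- r) *
      (Lp_norm (ereal s) cos / pi * hypergeom (s / 2) (s / 2) 1 (exp (- 2 * r / real n)) powr (1 / s) +
        \<theta> * r * real n powr (- 2) * exp (- r / real n)))"
proof -
  define q where "q = exp (- r / real n)"
  define B where "B = r * real n powr (- 2) * q"
  have q: "0 < q" "q \<le> 1 / 2" using exp_minus_quotient_bounds[OF n r(1)] by (auto simp: q_def)
  have q1: "0 \<le> q" "q < 1" using q by auto
  have n1: "n \<ge> 1" and r1: "r > 1" using n r by auto
  have s: "s \<ge> 1" using p by (rule conjugate_exponent_cases) auto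
  have p1: "1 \<le> p" using p by simp
  have B: "B > 0" using r1 q n by (simp add: B_def)
  have q2: "exp (- 2 * r / real n) = q\<^sup>2"
    by (simp add: q_def power2_eq_square flip: exp_add)
  define A where "A = grid_mean n q s powr (1 / s)"
  define H where "H = hypergeom (s / 2) (s / 2) 1 (q\<^sup>2) powr (1 / s)"
  define c where "c = cos_moment s powr (1 / s)"
  have c: "0 \<le> c" "c \<le> 2 * pi" "c = Lp_norm (ereal s) cos"
    using cos_moment_bounds[OF s] by (auto simp: c_def Lp_norm_def cos_moment_def)
  have X: "(grid_mean n q s * cos_moment s) powr (1 / s) = A * c"
    using grid_mean_approx(2)[OF n1 q1(1) q(2) s] cos_moment_bounds[OF s] by (simp add: A_def c_def powr_mult)
  let ?P = "step_kernel n q (\<beta> * pi / 2)"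
  note ext = step_kernel_extremal[where b = "\<beta> * pi / 2", OF n1 q1(1) q(2) p, unfolded X]
  obtain \<phi>0 where \<phi>0: "\<phi>0 \<in> Lp_ball0 p" "(LINT t:{-pi..pi}|lebesgue. \<phi>0 t * ?P (0 - t)) = A * c"
    using ext(2)[of 0] by blast
  have low: "A * c - 0 \<le> (LINT t:{-pi..pi}|lebesgue. \<phi>0 t * ?P (0 - t))" using \<phi>0(2) by simp
  obtain v where v: "fourier_error_C n (weyl_nagy_class r \<beta> p) = ereal (real n powr (- r) * v)"
    "\<bar>v - A * c / pi\<bar> \<le> ((2 * pi + 1) * (approx_const * B) + 0) / pi"
    using fourier_error_sandwich[OF n1 r1 p1 borel_measurable_step_kernel[OF q1] step_kernel_bound[OF q1]
        kernel_tail_approx[OF n r, folded q_def, folded approx_const_def B_def]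
        ext(1) \<phi>0(1) low] 
    by auto
  \<comment> \<open>The Riemann-sum error is of order q/n and is absorbed by \<open>B\<close>
    because r \<ge> n.\<close>
  have qn: "q / n \<le> B"
  proof -
    have n0: "real n > 0" using n by simp
    have "real n powr (- 2) = 1 / (real n)\<^sup>2"
      using n0 powr_minus_divide[of "real n" 2] powr_realpow[OF n0, of 2] by simp
    moreover have "1 / n \<le> r * (1 / (real n)\<^sup>2)"
      using r n0 by (simp add: field_simps power2_eq_square)
    ultimately show ?thesis
      using mult_right_mono[of "1 / n" "r * real n powr (- 2)" q] q by (simp add: B_def)
  qed
  have "A * c / pi - c / pi * H = c / pi * (A - H)" by (simp add: field_simps)
  then have "\<bar>A * c / pi - c / pi * H\<bar> = c / pi * \<bar>A - H\<bar>"
    using c by (simp add: abs_mult)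
  \<comment> \<open>The cosine norm is at most 2 pi, so the factor \<open>c / pi\<close> is at most
    2.\<close>
  also have "\<dots> \<le> 2 * (32 * pi * q / n)"
    using grid_mean_approx(1)[OF n1 q1(1) q(2) s] c
    by (intro mult_mono) (auto simp: A_def H_def pos_divide_le_eq)
  also have "\<dots> = 64 * pi * (q / n)" by simp
  also have "\<dots> \<le> 64 * pi * B" using qn by (intro mult_left_mono) auto
  finally have "\<bar>v - c / pi * H\<bar> \<le> ((2 * pi + 1) * (approx_const * B) + 0) / pi + 64 * pi * B"
    using v(2) by linarith
  also have "\<dots> \<le> error_const * B"
    using B by (simp add: error_const_def add_divide_distrib distrib_right mult.assoc)
  finally have "\<bar>v - c / pi * H\<bar> \<le> error_const * B" .
  from remainder_form[OF this B_def _ _ q(1)] obtain \<theta> where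
    "\<bar>\<theta>\<bar> \<le> error_const" "v = c / pi * H + \<theta> * r * real n powr (- 2) * q"
    using r1 n by auto
  then show ?thesis using v(1) unfolding q2 c(3) H_def q_def by blast
qed

theorem theorem2:
  "\<exists>K::real. \<forall>(n::nat) (r::real) (\<beta>::real). 1 \<le> n \<longrightarrow> 1 < r \<longrightarrow> real n + 1 \<le> r \<longrightarrow> r \<le> (real n)\<^sup>2 \<longrightarrow>
     (\<exists>\<theta>::real. \<bar>\<theta>\<bar> \<le> K \<and>
        fourier_error_C n (weyl_nagy_class r \<beta> 1) =
          ereal (real n powr (- r) *
            (1 / (pi * (1 - exp (- r / real n))) + \<theta> * r * real n powr (- 2) * exp (- r / real n)))) \<and>
     (\<forall>(p::ereal) (p'::real). 1 < p \<longrightarrow> p \<le> \<infinity> \<longrightarrow> 1 / p + 1 / ereal p' = 1 \<longrightarrow>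
        (\<exists>\<theta>::real. \<bar>\<theta>\<bar> \<le> K \<and>
          fourier_error_C n (weyl_nagy_class r \<beta> p) =
            ereal (real n powr (- r) *
              (Lp_norm (ereal p') cos / pi *
                 hypergeom (p' / 2) (p' / 2) 1 (exp (- 2 * r / real n)) powr (1 / p') +
               \<theta> * r * real n powr (- 2) * exp (- r / real n)))))"
proof (intro exI[of _ error_const] allI impI)
  fix n :: nat and r \<beta> :: real
  assume n: "1 \<le> n" and r: "real n + 1 \<le> r" "r \<le> (real n)\<^sup>2"
  \<comment> \<open>For n = 1 the hypotheses would read 2 \<le> r \<le> 1, so the estimates for n
    \<ge> 2 cover everything.\<close>
  have "n \<noteq> 1" using r by auto
  with n have "n \<ge> 2" by simp
  with fourier_error_L1[OF _ r] fourier_error_Lp[OF _ r]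
  show "(\<exists>\<theta>::real. \<bar>\<theta>\<bar> \<le> error_const \<and>
        fourier_error_C n (weyl_nagy_class r \<beta> 1) =
          ereal (real n powr (- r) *
            (1 / (pi * (1 - exp (- r / real n))) + \<theta> * r * real n powr (- 2) * exp (- r / real n)))) \<and>
     (\<forall>(p::ereal) (p'::real). 1 < p \<longrightarrow> p \<le> \<infinity> \<longrightarrow> 1 / p + 1 / ereal p' = 1 \<longrightarrow>
        (\<exists>\<theta>::real. \<bar>\<theta>\<bar> \<le> error_const \<and>
          fourier_error_C n (weyl_nagy_class r \<beta> p) =
            ereal (real n powr (- r) *
              (Lp_norm (ereal p') cos / pi *
                 hypergeom (p' / 2) (p' / 2) 1 (exp (- 2 * r / real n)) powr (1 / p') +
               \<theta> * r * real n powr (- 2) * exp (- r / real n)))))"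
    by blast
qed

end
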